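(* Let $\mathcal{O}_0$ be a (possibly infinite) set of closed formulas of $\Omega$, let $\varphi$ be a closed formula of $\Omega$, let $\Gamma=\mathcal{O}_0\cup\{\varphi\}$, and let $\Delta_0$ be the set of all constants occurring in formulas of $\Gamma$, and assume $\Delta_0$ is finite. Then in the finite variation of the game, Proponent has a winning strategy starting from the position $\mathcal{C}_0=(\mathcal{O}_0,\{\varphi\},\Delta_0)$ if and only if $\mathcal{O}_0\vDash_{finN}\varphi$.
   Context: Language: $\Omega$ is a first-order intuitionistic language with predicate symbols and constants but no function symbols; connectives $\to,\wedge,\vee,\bot$ and quantifiers $\forall,\exists$; $\neg A$ abbreviates $A\to\bot$. Kripke frames are partially ordered sets of worlds together with an individual domain $\Delta_w$ at each world $w$, monotone along the order (the domains are considered part of the frame); a Kripke model adds an interpretation of constants and a monotone interpretation of atomic formulas, with the usual intuitionistic forcing clauses. For a class $X$ of frames, $T\vDash_X\varphi$ means: for every Kripke model based on a frame in $X$, if every formula of $T$ is true at every world of the model, then $\varphi$ is true at every world. $N$ is the class of Noetherian Kripke frames (no infinite strictly increasing sequence of worlds); $finN$ is the class of frames in $N$ all of whose individual domains are finite. The game. For a set of formulas $\Gamma$ and a set $\Delta$ of objects, $\mathcal{F}(\Gamma,\Delta)$ is the set of all formulas $P[c_1,\dots,c_n]$ where $P[x_1,\dots,x_n]$ is a subformula of some formula of $\Gamma$ whose free variables are among $x_1,\dots,x_n$ and $c_i\in\Delta$. A position is a triple $\mathcal{C}=(\mathcal{O},\mathcal{P},\Delta)$ with $\mathcal{O},\mathcal{P}\subseteq\mathcal{F}(\Gamma,\Delta)$,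 where $\Gamma$ is fixed at the start as $\mathcal{O}_0\cup\{\varphi\}$. Proponent moves by adding formulas of $\mathcal{F}(\Gamma,\Delta)$ to $\mathcal{P}$. Opponent moves by first extending $\Delta$ to some $\Delta'\supseteq\Delta$ (possibly $\Delta'=\Delta$; new elements may be arbitrary new objects) and then adding formulas of $\mathcal{F}(\Gamma,\Delta')$ to $\mathcal{O}$. In the finite variation of the game, $\Delta_0$ is finite and Opponent may add only finitely many new elements to $\Delta$ in a single move. Truth in a position, for formulas of $\mathcal{F}(\Gamma,\Delta)$: $\mathcal{C}\nVdash\bot$; for atomic $A[c_1,\dots,c_n]$, $\mathcal{C}\Vdash A[c_1,\dots,c_n]$ iff $A[c_1,\dots,c_n]\in\mathcal{O}$; for $\star\in\{\to,\wedge,\vee\}$, $\mathcal{C}\Vdash\psi\star\chi$ iff $\psi\star\chi\in\mathcal{O}\cup\mathcal{P}$ and $(\mathcal{C}\Vdash\psi)\star(\mathcal{C}\Vdash\chi)$ holds with $\star$ read classically; for $q\in\{\forall,\exists\}$, $\mathcal{C}\Vdash qxP[x]$ iff $qxP[x]\in\mathcal{O}\cup\mathcal{P}$ and for $q$ (read classically) $\alpha\in\Delta$, $\mathcal{C}\Vdash P[\alpha]$. A formula of $\mathcal{P}$ (resp. $\mathcal{O}$) false in the current position is a mistake of Proponent (resp. Opponent). If Opponent has no mistakes but Proponent has a mistake, Proponent must move; otherwise Opponent must move. If after a player's move that same player must move again, that player loses and the game ends. If the game continues infinitely, Proponent wins.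
   Formalization: Individual domains may be empty and models need only interpret constants occurring in Γ; if Δ₀ is empty while Ω has constants (so domains are nonempty), the literal claim fails for ∀xPx→∃xPx, which is valid although Opponent wins from Δ=∅. *)

theory Defs
  imports Main "HOL-Library.Extended_Nat"
begin

section \<open>Syntax\<close>

text \<open>The type \<open>'o\<close> is the universe of objects: it contains the constants of the language and
  the objects that may be introduced in the course of the game.  A predicate symbol
  is a name in \<open>'p\<close> together with a number of arguments.\<close>

datatype 'o trm = Var nat | Obj 'o

datatype (fm_preds: 'p, fm_consts: 'o) fm =
    Bot
  | Atom 'p "'o trm list"
  | Imp "('p, 'o) fm" "('p, 'o) fm"
  | Con "('p, 'o) fm" "('p, 'o) fm"
  | Dis "('p, 'o) fm" "('p, 'o) fm"
  | All nat "('p, 'o) fm"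
  | Exi nat "('p, 'o) fm"

primrec trm_vars :: "'o trm \<Rightarrow> nat set" where
  "trm_vars (Var x) = {x}"
| "trm_vars (Obj c) = {}"

primrec free_vars :: "('p, 'o) fm \<Rightarrow> nat set" where
  "free_vars Bot = {}"
| "free_vars (Atom p ts) = (\<Union>t\<in>set ts. trm_vars t)"
| "free_vars (Imp A B) = free_vars A \<union> free_vars B"
| "free_vars (Con A B) = free_vars A \<union> free_vars B"
| "free_vars (Dis A B) = free_vars A \<union> free_vars B"
| "free_vars (All x A) = free_vars A - {x}"
| "free_vars (Exi x A) = free_vars A - {x}"

definition closed_fm :: "('p, 'o) fm \<Rightarrow> bool" where
  "closed_fm A \<longleftrightarrow> free_vars A = {}"

definition constants_of :: "('p, 'o) fm set \<Rightarrow> 'o set" where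
  "constants_of \<Gamma> = (\<Union>A\<in>\<Gamma>. fm_consts A)"

primrec subfms :: "('p, 'o) fm \<Rightarrow> ('p, 'o) fm set" where
  "subfms Bot = {Bot}"
| "subfms (Atom p ts) = {Atom p ts}"
| "subfms (Imp A B) = insert (Imp A B) (subfms A \<union> subfms B)"
| "subfms (Con A B) = insert (Con A B) (subfms A \<union> subfms B)"
| "subfms (Dis A B) = insert (Dis A B) (subfms A \<union> subfms B)"
| "subfms (All x A) = insert (All x A) (subfms A)"
| "subfms (Exi x A) = insert (Exi x A) (subfms A)"

primrec trm_inst :: "(nat \<Rightarrow> 'o trm) \<Rightarrow> 'o trm \<Rightarrow> 'o trm" where
  "trm_inst s (Var x) = s x"
| "trm_inst s (Obj c) = Obj c"

text \<open>Simultaneous substitution for the free variables.  It is only used with substitutions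
  mapping each variable to an object or to itself, so no variable can be captured.\<close>

primrec inst :: "(nat \<Rightarrow> 'o trm) \<Rightarrow> ('p, 'o) fm \<Rightarrow> ('p, 'o) fm" where
  "inst s Bot = Bot"
| "inst s (Atom p ts) = Atom p (map (trm_inst s) ts)"
| "inst s (Imp A B) = Imp (inst s A) (inst s B)"
| "inst s (Con A B) = Con (inst s A) (inst s B)"
| "inst s (Dis A B) = Dis (inst s A) (inst s B)"
| "inst s (All x A) = All x (inst (s(x := Var x)) A)"
| "inst s (Exi x A) = Exi x (inst (s(x := Var x)) A)"

definition subst :: "nat \<Rightarrow> 'o \<Rightarrow> ('p, 'o) fm \<Rightarrow> ('p, 'o) fm" where
  "subst x a A = inst (Var(x := Obj a)) A"

primrec depth :: "('p, 'o) fm \<Rightarrow> nat" where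
  "depth Bot = 0"
| "depth (Atom p ts) = 0"
| "depth (Imp A B) = Suc (depth A + depth B)"
| "depth (Con A B) = Suc (depth A + depth B)"
| "depth (Dis A B) = Suc (depth A + depth B)"
| "depth (All x A) = Suc (depth A)"
| "depth (Exi x A) = Suc (depth A)"

lemma depth_inst [simp]: "depth (inst s A) = depth A"
  by (induction A arbitrary: s) auto

lemma depth_subst [simp]: "depth (subst x a A) = depth A"
  by (simp add: subst_def)


section \<open>Kripke semantics\<close>

record ('w, 'i) kframe =
  worlds :: "'w set"
  acc :: "'w rel"
  indiv :: "'w \<Rightarrow> 'i set"

definition is_kframe :: "('w, 'i) kframe \<Rightarrow> bool" where
  "is_kframe F \<longleftrightarrow>
     partial_order_on (worlds F) (acc F) \<and>
     (\<forall>w v. (w, v) \<in> acc F \<longrightarrow> indiv F w \<subseteq> indiv F v)"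

definition frames_N :: "('w, 'i) kframe set" where
  "frames_N = {F. is_kframe F \<and>
     \<not> (\<exists>f :: nat \<Rightarrow> 'w. \<forall>n. (f n, f (Suc n)) \<in> acc F \<and> f n \<noteq> f (Suc n))}"

definition frames_finN :: "('w, 'i) kframe set" where
  "frames_finN = {F \<in> frames_N. \<forall>w \<in> worlds F. finite (indiv F w)}"

text \<open>A model on \<open>F\<close> for the language with constants \<open>K\<close>, given by the interpretation \<open>I\<close> of
  the constants and \<open>R\<close> of the predicate symbols.\<close>

definition is_kmodel ::
  "'o set \<Rightarrow> ('w, 'i) kframe \<Rightarrow> ('o \<Rightarrow> 'i) \<Rightarrow> ('w \<Rightarrow> 'p \<Rightarrow> 'i list set) \<Rightarrow> bool" where
  "is_kmodel K F I R \<longleftrightarrow>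
     (\<forall>c \<in> K. \<forall>w \<in> worlds F. I c \<in> indiv F w) \<and>
     (\<forall>w \<in> worlds F. \<forall>p. R w p \<subseteq> lists (indiv F w)) \<and>
     (\<forall>w v p. (w, v) \<in> acc F \<longrightarrow> R w p \<subseteq> R v p)"

primrec trm_val :: "('o \<Rightarrow> 'i) \<Rightarrow> (nat \<Rightarrow> 'i) \<Rightarrow> 'o trm \<Rightarrow> 'i" where
  "trm_val I e (Var x) = e x"
| "trm_val I e (Obj c) = I c"

primrec forces :: "('w, 'i) kframe \<Rightarrow> ('o \<Rightarrow> 'i) \<Rightarrow> ('w \<Rightarrow> 'p \<Rightarrow> 'i list set) \<Rightarrow>
    'w \<Rightarrow> (nat \<Rightarrow> 'i) \<Rightarrow> ('p, 'o) fm \<Rightarrow> bool" where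
  "forces F I R w e Bot \<longleftrightarrow> False"
| "forces F I R w e (Atom p ts) \<longleftrightarrow> map (trm_val I e) ts \<in> R w p"
| "forces F I R w e (Imp A B) \<longleftrightarrow>
     (\<forall>v. (w, v) \<in> acc F \<longrightarrow> forces F I R v e A \<longrightarrow> forces F I R v e B)"
| "forces F I R w e (Con A B) \<longleftrightarrow> forces F I R w e A \<and> forces F I R w e B"
| "forces F I R w e (Dis A B) \<longleftrightarrow> forces F I R w e A \<or> forces F I R w e B"
| "forces F I R w e (All x A) \<longleftrightarrow>
     (\<forall>v. (w, v) \<in> acc F \<longrightarrow> (\<forall>d \<in> indiv F v. forces F I R v (e(x := d)) A))"
| "forces F I R w e (Exi x A) \<longleftrightarrow> (\<exists>d \<in> indiv F w. forces F I R w (e(x := d)) A)"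

text \<open>Truth of a closed formula throughout a model; the environment is then irrelevant.\<close>

definition true_in :: "('w, 'i) kframe \<Rightarrow> ('o \<Rightarrow> 'i) \<Rightarrow> ('w \<Rightarrow> 'p \<Rightarrow> 'i list set) \<Rightarrow>
    ('p, 'o) fm \<Rightarrow> bool" where
  "true_in F I R A \<longleftrightarrow> (\<forall>w \<in> worlds F. \<forall>e. forces F I R w e A)"

text \<open>Individual domains may be empty.  Only the constants that occur in \<open>T\<close> and \<open>\<phi>\<close> have to
  denote: otherwise a constant that is not mentioned would exclude the empty domains, and then
  \<open>(\<forall>x. P x) \<longrightarrow> (\<exists>x. P x)\<close> would be valid although Opponent wins from \<open>\<Delta> = {}\<close>.\<close>

definition entails :: "('w, 'i) kframe set \<Rightarrow> ('p, 'o) fm set \<Rightarrow> ('p, 'o) fm \<Rightarrow> bool" where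
  "entails X T \<phi> \<longleftrightarrow>
     (\<forall>F \<in> X. \<forall>I R. is_kmodel (constants_of (insert \<phi> T)) F I R \<longrightarrow>
        (\<forall>A \<in> T. true_in F I R A) \<longrightarrow> true_in F I R \<phi>)"


section \<open>The game\<close>

definition instances :: "('p, 'o) fm set \<Rightarrow> 'o set \<Rightarrow> ('p, 'o) fm set" where
  "instances \<Gamma> \<Delta> = {inst (Obj \<circ> s) A | s A.
     A \<in> (\<Union>B\<in>\<Gamma>. subfms B) \<and> s ` free_vars A \<subseteq> \<Delta>}"

datatype ('p, 'o) position =
  Position (opp_fms: "('p, 'o) fm set") (prop_fms: "('p, 'o) fm set") (objs: "'o set")

function holds :: "('p, 'o) position \<Rightarrow> ('p, 'o) fm \<Rightarrow> bool" where
  "holds C Bot \<longleftrightarrow> False"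
| "holds C (Atom p ts) \<longleftrightarrow> Atom p ts \<in> opp_fms C"
| "holds C (Imp A B) \<longleftrightarrow> Imp A B \<in> opp_fms C \<union> prop_fms C \<and> (holds C A \<longrightarrow> holds C B)"
| "holds C (Con A B) \<longleftrightarrow> Con A B \<in> opp_fms C \<union> prop_fms C \<and> (holds C A \<and> holds C B)"
| "holds C (Dis A B) \<longleftrightarrow> Dis A B \<in> opp_fms C \<union> prop_fms C \<and> (holds C A \<or> holds C B)"
| "holds C (All x A) \<longleftrightarrow> All x A \<in> opp_fms C \<union> prop_fms C \<and> (\<forall>a \<in> objs C. holds C (subst x a A))"
| "holds C (Exi x A) \<longleftrightarrow> Exi x A \<in> opp_fms C \<union> prop_fms C \<and> (\<exists>a \<in> objs C. holds C (subst x a A))"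
  by pat_completeness auto
termination
  by (relation "measure (depth \<circ> snd)") auto

datatype player = Proponent | Opponent

primrec adversary :: "player \<Rightarrow> player" where
  "adversary Proponent = Opponent"
| "adversary Opponent = Proponent"

definition opp_mistake :: "('p, 'o) position \<Rightarrow> bool" where
  "opp_mistake C \<longleftrightarrow> (\<exists>A \<in> opp_fms C. \<not> holds C A)"

definition prop_mistake :: "('p, 'o) position \<Rightarrow> bool" where
  "prop_mistake C \<longleftrightarrow> (\<exists>A \<in> prop_fms C. \<not> holds C A)"

definition turn :: "('p, 'o) position \<Rightarrow> player" where
  "turn C = (if \<not> opp_mistake C \<and> prop_mistake C then Proponent else Opponent)"

definition prop_move :: "('p, 'o) fm set \<Rightarrow> ('p, 'o) position \<Rightarrow> ('p, 'o) position \<Rightarrow> bool" where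
  "prop_move \<Gamma> C C' \<longleftrightarrow>
     (\<exists>X \<subseteq> instances \<Gamma> (objs C). C' = Position (opp_fms C) (prop_fms C \<union> X) (objs C))"

text \<open>The finite variation: only finitely many objects are added in a single move.\<close>

definition fin_opp_move :: "('p, 'o) fm set \<Rightarrow> ('p, 'o) position \<Rightarrow> ('p, 'o) position \<Rightarrow> bool" where
  "fin_opp_move \<Gamma> C C' \<longleftrightarrow>
     (\<exists>E. finite E \<and> (\<exists>X \<subseteq> instances \<Gamma> (objs C \<union> E).
        C' = Position (opp_fms C \<union> X) (prop_fms C) (objs C \<union> E)))"

definition move :: "('p, 'o) fm set \<Rightarrow> ('p, 'o) position \<Rightarrow> ('p, 'o) position \<Rightarrow> bool" where
  "move \<Gamma> C C' \<longleftrightarrow>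
     (case turn C of Proponent \<Rightarrow> prop_move \<Gamma> C C' | Opponent \<Rightarrow> fin_opp_move \<Gamma> C C')"

text \<open>A complete play consists of \<open>N\<close> moves (possibly \<open>\<infinity>\<close>) through the positions \<open>f i\<close> with
  \<open>i \<le> N\<close>.  It ends exactly with the first move after which the mover must move again.\<close>

definition play ::
  "('p, 'o) fm set \<Rightarrow> ('p, 'o) position \<Rightarrow> (nat \<Rightarrow> ('p, 'o) position) \<Rightarrow> enat \<Rightarrow> bool" where
  "play \<Gamma> C\<^sub>0 f N \<longleftrightarrow> f 0 = C\<^sub>0 \<and> N \<noteq> 0 \<and>
     (\<forall>i. enat i < N \<longrightarrow> move \<Gamma> (f i) (f (Suc i)) \<and>
        (turn (f (Suc i)) = turn (f i) \<longleftrightarrow> enat (Suc i) = N))"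

definition winner :: "(nat \<Rightarrow> ('p, 'o) position) \<Rightarrow> enat \<Rightarrow> player" where
  "winner f N = (case N of enat n \<Rightarrow> adversary (turn (f n)) | \<infinity> \<Rightarrow> Proponent)"

text \<open>A strategy of Proponent maps the list of all positions so far to the next position.\<close>

definition prop_strategy ::
  "('p, 'o) fm set \<Rightarrow> (('p, 'o) position list \<Rightarrow> ('p, 'o) position) \<Rightarrow> bool" where
  "prop_strategy \<Gamma> \<sigma> \<longleftrightarrow>
     (\<forall>h. h \<noteq> [] \<longrightarrow> turn (last h) = Proponent \<longrightarrow> prop_move \<Gamma> (last h) (\<sigma> h))"

definition follows :: "(('p, 'o) position list \<Rightarrow> ('p, 'o) position) \<Rightarrow>
    (nat \<Rightarrow> ('p, 'o) position) \<Rightarrow> enat \<Rightarrow> bool" where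
  "follows \<sigma> f N \<longleftrightarrow>
     (\<forall>i. enat i < N \<longrightarrow> turn (f i) = Proponent \<longrightarrow> f (Suc i) = \<sigma> (map f [0..<Suc i]))"

definition proponent_wins :: "('p, 'o) fm set \<Rightarrow> ('p, 'o) position \<Rightarrow> bool" where
  "proponent_wins \<Gamma> C\<^sub>0 \<longleftrightarrow>
     (\<exists>\<sigma>. prop_strategy \<Gamma> \<sigma> \<and>
        (\<forall>f N. play \<Gamma> C\<^sub>0 f N \<longrightarrow> follows \<sigma> f N \<longrightarrow> winner f N = Proponent))"

end

theory Submission
  imports Defs
begin

text \<open>If a Noetherian model with finite domains refutes \<open>\<phi>\<close>, Opponent keeps a current world \<open>w\<close>
  that refutes some formula of \<open>P\<close>.  He moves to a maximal such world, names its individuals and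
  asserts everything forced there.  Truth in the position then coincides with forcing at the world,
  so he makes no mistake, and Proponent can only hand over the turn by asserting
  a formula that fails at a strictly larger world.  The play ends because the frame is Noetherian.

  Conversely, the game is open for Opponent, hence determined, and the set of positions won by
  Opponent carries a well-founded rank that decreases along a winning strategy.  Ordered by rank
  and inclusion, suitable won positions with Proponent to move form a Noetherian frame, with the
  objects as individuals, in which \<open>O\<close> is forced and some formula of \<open>P\<close> is refuted.\<close>

section \<open>Substitution and instances\<close>

text \<open>The hypothesis excludes capture: under a binder for \<open>y\<close>, a value
  \<open>s x\<close> with \<open>x\<close> other than \<open>y\<close> is \<open>x\<close> itself or
  an object, so resetting \<open>t\<close> at \<open>y\<close> does not touch it.\<close>

lemma inst_inst:
  assumes "\<And>x. s x = Var x \<or> (\<exists>c. s x = Obj c)"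
  shows "inst t (inst s A) = inst (\<lambda>x. trm_inst t (s x)) A"
  using assms
proof (induction A arbitrary: s t)
  case (Atom p ts)
  have "trm_inst t (trm_inst s u) = trm_inst (\<lambda>x. trm_inst t (s x)) u" for u
    by (cases u) auto
  then show ?case by simp
next
  case (All y A)
  have "inst (t(y := Var y)) (inst (s(y := Var y)) A) =
      inst (\<lambda>x. trm_inst (t(y := Var y)) ((s(y := Var y)) x)) A"
    by (rule All.IH) (use All.prems in auto)
  moreover have "(\<lambda>x. trm_inst (t(y := Var y)) ((s(y := Var y)) x)) =
      (\<lambda>x. trm_inst t (s x))(y := Var y)"
  proof
    fix x show "trm_inst (t(y := Var y)) ((s(y := Var y)) x) = ((\<lambda>x. trm_inst t (s x))(y := Var y)) x"
      using All.prems[of x] by auto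
  qed
  ultimately show ?case by simp
next
  case (Exi y A)
  have "inst (t(y := Var y)) (inst (s(y := Var y)) A) =
      inst (\<lambda>x. trm_inst (t(y := Var y)) ((s(y := Var y)) x)) A"
    by (rule Exi.IH) (use Exi.prems in auto)
  moreover have "(\<lambda>x. trm_inst (t(y := Var y)) ((s(y := Var y)) x)) =
      (\<lambda>x. trm_inst t (s x))(y := Var y)"
  proof
    fix x show "trm_inst (t(y := Var y)) ((s(y := Var y)) x) = ((\<lambda>x. trm_inst t (s x))(y := Var y)) x"
      using Exi.prems[of x] by auto
  qed
  ultimately show ?case by simp
qed simp_all

lemma inst_idle: "(\<And>x. x \<in> free_vars A \<Longrightarrow> s x = Var x) \<Longrightarrow> inst s A = A"
proof (induction A arbitrary: s)
  case (Atom p ts)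
  have "trm_inst s u = u" if "u \<in> set ts" for u
    using Atom that by (cases u) force+
  then show ?case by (simp add: map_idI)
qed auto

lemma fm_consts_inst:
  "fm_consts (inst s A) \<subseteq> fm_consts A \<union> (\<Union>x\<in>free_vars A. set_trm (s x))"
proof (induction A arbitrary: s)
  case (Atom p ts)
  have "set_trm (trm_inst s u) \<subseteq> set_trm u \<union> (\<Union>x\<in>trm_vars u. set_trm (s x))" for u
    by (cases u) auto
  then show ?case by fastforce
next
  case (All y A)
  have "(\<Union>x\<in>free_vars A. set_trm ((s(y := Var y)) x)) \<subseteq> (\<Union>x\<in>free_vars A - {y}. set_trm (s x))"
    by (auto split: if_splits)
  from order_trans[OF All.IH Un_mono[OF order_refl this]] show ?case by (simp add: fun_upd_def)
next
  case (Exi y A)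
  have "(\<Union>x\<in>free_vars A. set_trm ((s(y := Var y)) x)) \<subseteq> (\<Union>x\<in>free_vars A - {y}. set_trm (s x))"
    by (auto split: if_splits)
  from order_trans[OF Exi.IH Un_mono[OF order_refl this]] show ?case by (simp add: fun_upd_def)
next
  case (Imp A B)
  from Imp.IH[of s] show ?case unfolding inst.simps free_vars.simps fm.set UN_Un by blast
next
  case (Con A B)
  from Con.IH[of s] show ?case unfolding inst.simps free_vars.simps fm.set UN_Un by blast
next
  case (Dis A B)
  from Dis.IH[of s] show ?case unfolding inst.simps free_vars.simps fm.set UN_Un by blast
qed simp

lemma fm_consts_subfms: "A \<in> subfms B \<Longrightarrow> fm_consts A \<subseteq> fm_consts B"
  by (induction B) auto

lemma subfms_refl: "A \<in> subfms A"
  by (cases A) auto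

lemma subfms_trans: "A \<in> subfms B \<Longrightarrow> subfms A \<subseteq> subfms B"
  by (induction B) auto

section \<open>Instances of subformulas and their closure properties\<close>

lemma instances_mono: "\<Delta> \<subseteq> \<Delta>' \<Longrightarrow> instances \<Gamma> \<Delta> \<subseteq> instances \<Gamma> \<Delta>'"
  unfolding instances_def by blast

lemma instancesI:
  "\<lbrakk>A \<in> subfms B; B \<in> \<Gamma>; s ` free_vars A \<subseteq> \<Delta>; A' = inst (Obj \<circ> s) A\<rbrakk> \<Longrightarrow> A' \<in> instances \<Gamma> \<Delta>"
  unfolding instances_def by blast

lemma instancesE:
  assumes "A' \<in> instances \<Gamma> \<Delta>"
  obtains A B s where "A \<in> subfms B" "B \<in> \<Gamma>" "s ` free_vars A \<subseteq> \<Delta>" "A' = inst (Obj \<circ> s) A"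
  using assms unfolding instances_def by blast

lemma instances_closed: "A \<in> \<Gamma> \<Longrightarrow> closed_fm A \<Longrightarrow> A \<in> instances \<Gamma> \<Delta>"
  \<comment> \<open>A closed formula is its own instance under every assignment, so an arbitrary one
    serves.\<close>
  by (rule instancesI[of A A _ undefined])
    (auto simp: subfms_refl closed_fm_def intro!: inst_idle[symmetric])

lemma fm_consts_instances:
  assumes "A \<in> instances \<Gamma> \<Delta>" "constants_of \<Gamma> \<subseteq> \<Delta>"
  shows "fm_consts A \<subseteq> \<Delta>"
proof -
  obtain A' B s where *: "A' \<in> subfms B" "B \<in> \<Gamma>" "s ` free_vars A' \<subseteq> \<Delta>" "A = inst (Obj \<circ> s) A'"
    using assms(1) by (rule instancesE)
  have "fm_consts A' \<subseteq> constants_of \<Gamma>"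
    using fm_consts_subfms[OF *(1)] *(2) by (auto simp: constants_of_def)
  then show ?thesis
    using fm_consts_inst[of "Obj \<circ> s" A'] *(3,4) assms(2) by fastforce
qed

lemma instances_Imp:
  assumes "Imp A B \<in> instances \<Gamma> \<Delta>"
  shows "A \<in> instances \<Gamma> \<Delta>" "B \<in> instances \<Gamma> \<Delta>"
proof -
  obtain C D s where *: "C \<in> subfms D" "D \<in> \<Gamma>" "s ` free_vars C \<subseteq> \<Delta>" "Imp A B = inst (Obj \<circ> s) C"
    using assms by (rule instancesE)
  obtain A' B' where C: "C = Imp A' B'" "A = inst (Obj \<circ> s) A'" "B = inst (Obj \<circ> s) B'"
    using *(4) by (cases C) auto
  have "A' \<in> subfms D" "B' \<in> subfms D"
    using subfms_trans[OF *(1)] subfms_refl C(1) by auto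
  then show "A \<in> instances \<Gamma> \<Delta>" "B \<in> instances \<Gamma> \<Delta>"
    using * C instancesI[of A' D \<Gamma> s] instancesI[of B' D \<Gamma> s] by (auto simp: image_Un)
qed

lemma instances_Con:
  assumes "Con A B \<in> instances \<Gamma> \<Delta>"
  shows "A \<in> instances \<Gamma> \<Delta>" "B \<in> instances \<Gamma> \<Delta>"
proof -
  obtain C D s where *: "C \<in> subfms D" "D \<in> \<Gamma>" "s ` free_vars C \<subseteq> \<Delta>" "Con A B = inst (Obj \<circ> s) C"
    using assms by (rule instancesE)
  obtain A' B' where C: "C = Con A' B'" "A = inst (Obj \<circ> s) A'" "B = inst (Obj \<circ> s) B'"
    using *(4) by (cases C) auto
  have "A' \<in> subfms D" "B' \<in> subfms D"
    using subfms_trans[OF *(1)] subfms_refl C(1) by auto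
  then show "A \<in> instances \<Gamma> \<Delta>" "B \<in> instances \<Gamma> \<Delta>"
    using * C instancesI[of A' D \<Gamma> s] instancesI[of B' D \<Gamma> s] by (auto simp: image_Un)
qed

lemma instances_Dis:
  assumes "Dis A B \<in> instances \<Gamma> \<Delta>"
  shows "A \<in> instances \<Gamma> \<Delta>" "B \<in> instances \<Gamma> \<Delta>"
proof -
  obtain C D s where *: "C \<in> subfms D" "D \<in> \<Gamma>" "s ` free_vars C \<subseteq> \<Delta>" "Dis A B = inst (Obj \<circ> s) C"
    using assms by (rule instancesE)
  obtain A' B' where C: "C = Dis A' B'" "A = inst (Obj \<circ> s) A'" "B = inst (Obj \<circ> s) B'"
    using *(4) by (cases C) auto
  have "A' \<in> subfms D" "B' \<in> subfms D"
    using subfms_trans[OF *(1)] subfms_refl C(1) by auto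
  then show "A \<in> instances \<Gamma> \<Delta>" "B \<in> instances \<Gamma> \<Delta>"
    using * C instancesI[of A' D \<Gamma> s] instancesI[of B' D \<Gamma> s] by (auto simp: image_Un)
qed

text \<open>Instantiation leaves a bound variable in place; filling it in later amounts to updating
  the assignment. This keeps quantifier instances inside \<open>instances\<close>.\<close>

lemma subst_inst_bound:
  "subst x a (inst ((Obj \<circ> s)(x := Var x)) A) = inst (Obj \<circ> s(x := a)) A"
proof -
  have "(\<lambda>y. trm_inst (Var(x := Obj a)) (((Obj \<circ> s)(x := Var x)) y)) = Obj \<circ> s(x := a)"
    by auto
  then show ?thesis
    by (auto simp: subst_def inst_inst)
qed

lemma instances_All:
  assumes "All x A \<in> instances \<Gamma> \<Delta>" "a \<in> \<Delta>"
  shows "subst x a A \<in> instances \<Gamma> \<Delta>"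
proof -
  obtain C D s where *: "C \<in> subfms D" "D \<in> \<Gamma>" "s ` free_vars C \<subseteq> \<Delta>" "All x A = inst (Obj \<circ> s) C"
    using assms(1) by (rule instancesE)
  obtain A' where C: "C = All x A'" "A = inst ((Obj \<circ> s)(x := Var x)) A'"
    using *(4) by (cases C) auto
  have "A' \<in> subfms D"
    using subfms_trans[OF *(1)] subfms_refl C(1) by auto
  moreover have "s(x := a) ` free_vars A' \<subseteq> \<Delta>"
    using *(3) C(1) assms(2) by (simp add: image_subset_iff)
  ultimately show ?thesis
    using *(2) C(2) by (intro instancesI[of A' D]) (auto simp: subst_inst_bound)
qed

lemma instances_Exi:
  assumes "Exi x A \<in> instances \<Gamma> \<Delta>" "a \<in> \<Delta>"
  shows "subst x a A \<in> instances \<Gamma> \<Delta>"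
proof -
  obtain C D s where *: "C \<in> subfms D" "D \<in> \<Gamma>" "s ` free_vars C \<subseteq> \<Delta>" "Exi x A = inst (Obj \<circ> s) C"
    using assms(1) by (rule instancesE)
  obtain A' where C: "C = Exi x A'" "A = inst ((Obj \<circ> s)(x := Var x)) A'"
    using *(4) by (cases C) auto
  have "A' \<in> subfms D"
    using subfms_trans[OF *(1)] subfms_refl C(1) by auto
  moreover have "s(x := a) ` free_vars A' \<subseteq> \<Delta>"
    using *(3) C(1) assms(2) by (simp add: image_subset_iff)
  ultimately show ?thesis
    using *(2) C(2) by (intro instancesI[of A' D]) (auto simp: subst_inst_bound)
qed

text \<open>The assignment is total, so no variable survives in an atomic instance.\<close>

lemma instances_Atom:
  assumes "Atom p ts \<in> instances \<Gamma> \<Delta>" "constants_of \<Gamma> \<subseteq> \<Delta>"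
  obtains cs where "ts = map Obj cs" "set cs \<subseteq> \<Delta>"
proof -
  obtain C D s where *: "C \<in> subfms D" "D \<in> \<Gamma>" "s ` free_vars C \<subseteq> \<Delta>" "Atom p ts = inst (Obj \<circ> s) C"
    using assms(1) by (rule instancesE)
  obtain us where us: "ts = map (trm_inst (Obj \<circ> s)) us"
    using *(4) by (cases C) auto
  define cs where "cs = map (\<lambda>u. case u of Var x \<Rightarrow> s x | Obj c \<Rightarrow> c) us"
  have "ts = map Obj cs"
    unfolding us cs_def by (auto split: trm.split)
  moreover have "set cs \<subseteq> \<Delta>"
    using fm_consts_instances[OF assms] \<open>ts = map Obj cs\<close> by auto
  ultimately show thesis by (rule that)
qed


section \<open>Forcing\<close>

text \<open>Serves two purposes: naming new individuals does not affect formulas already in play,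
  and the environment is irrelevant for closed formulas.\<close>

lemma forces_cong:
  assumes "\<And>x. x \<in> free_vars A \<Longrightarrow> e x = e' x" "\<And>c. c \<in> fm_consts A \<Longrightarrow> g c = g' c"
  shows "forces F g R w e A = forces F g' R w e' A"
  using assms
proof (induction A arbitrary: w e e')
  case (Atom p ts)
  have "trm_val g e u = trm_val g' e' u" if "u \<in> set ts" for u
    using Atom that by (cases u) force+
  then have "map (trm_val g e) ts = map (trm_val g' e') ts" by simp
  then show ?case by (simp only: forces.simps)
next
  case (Imp A B)
  have "forces F g R v e A = forces F g' R v e' A" "forces F g R v e B = forces F g' R v e' B" for v
    using Imp.prems by (auto intro!: Imp.IH)
  then show ?case by simp
next
  case (Con A B)
  have "forces F g R w e A = forces F g' R w e' A" "forces F g R w e B = forces F g' R w e' B"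
    using Con.prems by (auto intro!: Con.IH)
  then show ?case by simp
next
  case (Dis A B)
  have "forces F g R w e A = forces F g' R w e' A" "forces F g R w e B = forces F g' R w e' B"
    using Dis.prems by (auto intro!: Dis.IH)
  then show ?case by simp
next
  case (All x A)
  have "forces F g R v (e(x := d)) A = forces F g' R v (e'(x := d)) A" for v d
    using All.prems by (intro All.IH) auto
  then show ?case by simp
next
  case (Exi x A)
  have "forces F g R v (e(x := d)) A = forces F g' R v (e'(x := d)) A" for v d
    using Exi.prems by (intro Exi.IH) auto
  then show ?case by simp
qed simp

lemma forces_inst:
  assumes "\<And>x. s x = Var x \<or> (\<exists>c. s x = Obj c)"
  shows "forces F g R w e (inst s A) = forces F g R w (\<lambda>x. trm_val g e (s x)) A"
  using assms
proof (induction A arbitrary: w s e)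
  case (Atom p ts)
  have "trm_val g e (trm_inst s u) = trm_val g (\<lambda>x. trm_val g e (s x)) u" for u
    by (cases u) auto
  then show ?case by (simp add: comp_def)
next
  case (All y A)
  have "forces F g R v (e(y := d)) (inst (s(y := Var y)) A) =
      forces F g R v (\<lambda>x. trm_val g (e(y := d)) ((s(y := Var y)) x)) A" for v d
    by (rule All.IH) (use All.prems in auto)
  moreover have "(\<lambda>x. trm_val g (e(y := d)) ((s(y := Var y)) x)) =
      (\<lambda>x. trm_val g e (s x))(y := d)" for d
  proof
    fix x show "trm_val g (e(y := d)) ((s(y := Var y)) x) = ((\<lambda>x. trm_val g e (s x))(y := d)) x"
      using All.prems[of x] by auto
  qed
  ultimately show ?case by simp
next
  case (Exi y A)
  have "forces F g R v (e(y := d)) (inst (s(y := Var y)) A) =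
      forces F g R v (\<lambda>x. trm_val g (e(y := d)) ((s(y := Var y)) x)) A" for v d
    by (rule Exi.IH) (use Exi.prems in auto)
  moreover have "(\<lambda>x. trm_val g (e(y := d)) ((s(y := Var y)) x)) =
      (\<lambda>x. trm_val g e (s x))(y := d)" for d
  proof
    fix x show "trm_val g (e(y := d)) ((s(y := Var y)) x) = ((\<lambda>x. trm_val g e (s x))(y := d)) x"
      using Exi.prems[of x] by auto
  qed
  ultimately show ?case by simp
qed simp_all

lemma forces_subst: "forces F g R w e (subst x a A) = forces F g R w (e(x := g a)) A"
proof -
  have "(\<lambda>y. trm_val g e ((Var(x := Obj a)) y)) = e(x := g a)"
    by auto
  then show ?thesis
    by (auto simp: subst_def forces_inst)
qed

section \<open>Order properties of Kripke frames and persistence of forcing\<close>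

lemma is_kframe_refl: "is_kframe F \<Longrightarrow> w \<in> worlds F \<Longrightarrow> (w, w) \<in> acc F"
  by (auto simp: is_kframe_def partial_order_on_def preorder_on_def refl_on_def)

lemma is_kframe_trans: "is_kframe F \<Longrightarrow> (u, v) \<in> acc F \<Longrightarrow> (v, w) \<in> acc F \<Longrightarrow> (u, w) \<in> acc F"
  by (auto simp: is_kframe_def partial_order_on_def preorder_on_def elim: transE)

lemma is_kframe_antisym: "is_kframe F \<Longrightarrow> (u, v) \<in> acc F \<Longrightarrow> (v, u) \<in> acc F \<Longrightarrow> u = v"
  by (auto simp: is_kframe_def partial_order_on_def elim: antisymD)

lemma is_kframe_worlds:
  "is_kframe F \<Longrightarrow> (u, v) \<in> acc F \<Longrightarrow> u \<in> worlds F" "is_kframe F \<Longrightarrow> (u, v) \<in> acc F \<Longrightarrow> v \<in> worlds F"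
  by (auto simp: is_kframe_def partial_order_on_def preorder_on_def)

lemma is_kframe_indiv: "is_kframe F \<Longrightarrow> (u, v) \<in> acc F \<Longrightarrow> indiv F u \<subseteq> indiv F v"
  by (auto simp: is_kframe_def)

lemma forces_persistent:
  assumes F: "is_kframe F" and R: "\<forall>u v p. (u, v) \<in> acc F \<longrightarrow> R u p \<subseteq> R v p"
  shows "forces F g R w e A \<Longrightarrow> (w, v) \<in> acc F \<Longrightarrow> forces F g R v e A"
proof (induction A arbitrary: w v e)
  case (Atom p ts)
  then show ?case using R by (simp; blast)
next
  case (Imp A B)
  then show ?case by (auto intro: is_kframe_trans[OF F])
next
  case (All x A)
  then show ?case by (auto intro: is_kframe_trans[OF F])
next
  case (Exi x A)
  then show ?case using is_kframe_indiv[OF F] by fastforce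
qed auto

lemma holds_iff_forces:
  assumes F: "is_kframe F" "w \<in> worlds F"
    and dom: "g ` objs C = indiv F w"
    and forced: "\<And>A. \<lbrakk>A \<in> instances \<Gamma> (objs C); forces F g R w e A\<rbrakk> \<Longrightarrow> A \<in> opp_fms C \<union> prop_fms C"
    and atoms: "\<And>p ts. Atom p ts \<in> instances \<Gamma> (objs C) \<Longrightarrow>
      forces F g R w e (Atom p ts) \<longleftrightarrow> Atom p ts \<in> opp_fms C"
    and above: "\<And>A v. \<lbrakk>A \<in> opp_fms C \<union> prop_fms C; (w, v) \<in> acc F; v \<noteq> w\<rbrakk> \<Longrightarrow> forces F g R v e A"
    and "A \<in> instances \<Gamma> (objs C)"
  shows "holds C A \<longleftrightarrow> forces F g R w e A"
  using \<open>A \<in> instances \<Gamma> (objs C)\<close>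
proof (induction "depth A" arbitrary: A rule: less_induct)
  case less
  have refl: "(v, v) \<in> acc F" if "(w, v) \<in> acc F" for v
    using F that by (blast intro: is_kframe_refl is_kframe_worlds)
  have rw: "(w, w) \<in> acc F"
    using F by (rule is_kframe_refl)
  show ?case
  proof (cases A)
    case Bot
    then show ?thesis by simp
  next
    case (Atom p ts)
    then show ?thesis using atoms less.prems by simp
  next
    case (Imp B D)
    have IH: "holds C B \<longleftrightarrow> forces F g R w e B" "holds C D \<longleftrightarrow> forces F g R w e D"
      using less instances_Imp[of B D] Imp by auto
    show ?thesis
    proof
      assume h: "holds C A"
      have "forces F g R v e D" if v: "(w, v) \<in> acc F" "forces F g R v e B" for v
      proof (cases "v = w")
        case True
        then show ?thesis using h IH v Imp by auto
      next
        case False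
        \<comment> \<open>Classical truth at \<open>w\<close> says nothing about a strictly later
          \<open>v\<close>; there the asserted implication itself is forced, by
          \<open>above\<close>, and is applied at \<open>v\<close>.\<close>
        then have "forces F g R v e A"
          using h above[of A v] v Imp by auto
        then show ?thesis using refl[OF v(1)] v(2) Imp by auto
      qed
      then show "forces F g R w e A" using Imp by auto
    next
      assume f: "forces F g R w e A"
      then show "holds C A"
        using forced[OF less.prems f] IH rw Imp by auto
    qed
  next
    case (Con B D)
    have IH: "holds C B \<longleftrightarrow> forces F g R w e B" "holds C D \<longleftrightarrow> forces F g R w e D"
      using less instances_Con[of B D] Con by auto
    then show ?thesis using forced[OF less.prems] Con by auto
  next
    case (Dis B D)
    have IH: "holds C B \<longleftrightarrow> forces F g R w e B" "holds C D \<longleftrightarrow> forces F g R w e D"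
      using less instances_Dis[of B D] Dis by auto
    then show ?thesis using forced[OF less.prems] Dis by auto
  next
    case (All x B)
    have IH: "holds C (subst x a B) \<longleftrightarrow> forces F g R w (e(x := g a)) B" if "a \<in> objs C" for a
      using less.hyps[of "subst x a B"] less.prems instances_All[of x B \<Gamma> "objs C" a] All that
      by (simp add: forces_subst)
    show ?thesis
    proof
      assume h: "holds C A"
      have "forces F g R v (e(x := d)) B" if v: "(w, v) \<in> acc F" "d \<in> indiv F v" for v d
      proof (cases "v = w")
        case True
        then obtain a where "a \<in> objs C" "d = g a" using v dom by auto
        then show ?thesis using h IH True All by auto
      next
        case False
        then have "forces F g R v e A"
          using h above[of A v] v All by auto
        then show ?thesis using refl[OF v(1)] v(2) All by auto
      qed
      then show "forces F g R w e A" using All by auto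
    next
      assume f: "forces F g R w e A"
      then have "holds C (subst x a B)" if "a \<in> objs C" for a
        using IH[OF that] rw dom that All by auto
      then show "holds C A"
        using forced[OF less.prems f] All by auto
    qed
  next
    case (Exi x B)
    have IH: "holds C (subst x a B) \<longleftrightarrow> forces F g R w (e(x := g a)) B" if "a \<in> objs C" for a
      using less.hyps[of "subst x a B"] less.prems instances_Exi[of x B \<Gamma> "objs C" a] Exi that
      by (simp add: forces_subst)
    have "forces F g R w e A \<longleftrightarrow> (\<exists>a\<in>objs C. forces F g R w (e(x := g a)) B)"
      unfolding Exi forces.simps dom[symmetric] by blast
    then show ?thesis using forced[OF less.prems] IH Exi by auto
  qed
qed


section \<open>Positions and moves\<close>

text \<open>The invariant of reachable positions. Finiteness of the objects leaves room for fresh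
  names in one direction and gives finite domains in the other.\<close>

definition legal :: "('p, 'o) fm set \<Rightarrow> ('p, 'o) position \<Rightarrow> bool" where
  "legal \<Gamma> C \<longleftrightarrow> opp_fms C \<subseteq> instances \<Gamma> (objs C) \<and> prop_fms C \<subseteq> instances \<Gamma> (objs C) \<and>
     finite (objs C) \<and> constants_of \<Gamma> \<subseteq> objs C"

definition position_le :: "('p, 'o) position \<Rightarrow> ('p, 'o) position \<Rightarrow> bool" where
  "position_le C D \<longleftrightarrow>
     opp_fms C \<subseteq> opp_fms D \<and> prop_fms C \<subseteq> prop_fms D \<and> objs C \<subseteq> objs D"

lemma position_le_trans: "position_le A B \<Longrightarrow> position_le B C \<Longrightarrow> position_le A C"
  by (auto simp: position_le_def)

lemma prop_move_legal:
  "prop_move \<Gamma> C C' \<Longrightarrow> legal \<Gamma> C \<Longrightarrow> legal \<Gamma> C'" "prop_move \<Gamma> C C' \<Longrightarrow> position_le C C'"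
  by (auto simp: prop_move_def legal_def position_le_def)

lemma fin_opp_move_legal:
  assumes "fin_opp_move \<Gamma> C C'"
  shows "legal \<Gamma> C \<Longrightarrow> legal \<Gamma> C'" "position_le C C'"
proof -
  obtain E X where *: "finite E" "X \<subseteq> instances \<Gamma> (objs C \<union> E)"
    "C' = Position (opp_fms C \<union> X) (prop_fms C) (objs C \<union> E)"
    using assms by (auto simp: fin_opp_move_def)
  show "position_le C C'" using * by (auto simp: position_le_def)
  show "legal \<Gamma> C'" if "legal \<Gamma> C"
    using * that instances_mono[of "objs C" "objs C \<union> E" \<Gamma>] by (auto simp: legal_def)
qed

lemma turn_Proponent: "turn C = Proponent \<longleftrightarrow> \<not> opp_mistake C \<and> prop_mistake C"
  by (simp add: turn_def)

lemma not_Proponent: "p \<noteq> Proponent \<longleftrightarrow> p = Opponent"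
  by (cases p) auto


section \<open>A countermodel yields a play won by Opponent\<close>

text \<open>An initial segment of a play against \<open>\<sigma>\<close> that nobody has lost yet:
  every move has passed the turn.\<close>

definition partial_play :: "('p, 'o) fm set \<Rightarrow> (('p, 'o) position list \<Rightarrow> ('p, 'o) position) \<Rightarrow>
    ('p, 'o) position \<Rightarrow> (nat \<Rightarrow> ('p, 'o) position) \<Rightarrow> nat \<Rightarrow> bool" where
  "partial_play \<Gamma> \<sigma> C f n \<longleftrightarrow> f 0 = C \<and>
     (\<forall>i<n. move \<Gamma> (f i) (f (Suc i)) \<and> turn (f (Suc i)) \<noteq> turn (f i) \<and>
        (turn (f i) = Proponent \<longrightarrow> f (Suc i) = \<sigma> (map f [0..<Suc i])))"

lemma map_upd_Suc: "i \<le> n \<Longrightarrow> map (f(Suc n := C)) [0..<Suc i] = map f [0..<Suc i]"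
  by auto

lemma prop_strategy_move:
  assumes "prop_strategy \<Gamma> \<sigma>" "turn (f n) = Proponent"
  shows "prop_move \<Gamma> (f n) (\<sigma> (map f [0..<Suc n]))"
proof -
  have "last (map f [0..<Suc n]) = f n" by simp
  then show ?thesis
    using assms unfolding prop_strategy_def
    by (metis Nil_is_map_conv upt_Suc snoc_eq_iff_butlast zero_le)
qed

lemma partial_play_extend:
  assumes "partial_play \<Gamma> \<sigma> C f n" "move \<Gamma> (f n) D" "turn D \<noteq> turn (f n)"
    "turn (f n) = Proponent \<Longrightarrow> D = \<sigma> (map f [0..<Suc n])"
  shows "partial_play \<Gamma> \<sigma> C (f(Suc n := D)) (Suc n)"
  unfolding partial_play_def
proof (intro conjI allI impI)
  show "(f(Suc n := D)) 0 = C"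
    using assms(1) by (simp add: partial_play_def)
next
  fix i assume "i < Suc n"
  then consider "i < n" | "i = n" by linarith
  then show "move \<Gamma> ((f(Suc n := D)) i) ((f(Suc n := D)) (Suc i))"
    by cases (use assms in \<open>auto simp: partial_play_def\<close>)
next
  fix i assume "i < Suc n"
  then consider "i < n" | "i = n" by linarith
  then show "turn ((f(Suc n := D)) (Suc i)) \<noteq> turn ((f(Suc n := D)) i)"
    by cases (use assms in \<open>auto simp: partial_play_def\<close>)
next
  fix i assume i: "i < Suc n" and t: "turn ((f(Suc n := D)) i) = Proponent"
  have m: "map (f(Suc n := D)) [0..<Suc i] = map f [0..<Suc i]"
    using i by (intro map_upd_Suc) simp
  consider "i < n" | "i = n" using i by linarith
  then show "(f(Suc n := D)) (Suc i) = \<sigma> (map (f(Suc n := D)) [0..<Suc i])"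
    unfolding m by cases (use assms t in \<open>auto simp: partial_play_def\<close>)
qed

text \<open>All earlier moves passed the turn, so the play ends exactly at \<open>Suc n\<close>.
  This refutes a supposedly winning strategy that lets Proponent keep the turn.\<close>

lemma partial_play_lose:
  assumes "partial_play \<Gamma> \<sigma> C f n" "move \<Gamma> (f n) D" "turn D = turn (f n)"
    "turn (f n) = Proponent \<Longrightarrow> D = \<sigma> (map f [0..<Suc n])"
  shows "play \<Gamma> C (f(Suc n := D)) (enat (Suc n))" "follows \<sigma> (f(Suc n := D)) (enat (Suc n))"
    "winner (f(Suc n := D)) (enat (Suc n)) = adversary (turn (f n))"
proof -
  show "winner (f(Suc n := D)) (enat (Suc n)) = adversary (turn (f n))"
    using assms(3) by (simp add: winner_def)
  show "play \<Gamma> C (f(Suc n := D)) (enat (Suc n))"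
    unfolding play_def
  proof (intro conjI allI impI)
    show "(f(Suc n := D)) 0 = C"
      using assms(1) by (simp add: partial_play_def)
    show "enat (Suc n) \<noteq> 0" by (simp add: zero_enat_def)
  next
    fix i assume "enat i < enat (Suc n)"
    then consider "i < n" | "i = n" by fastforce
    then show "move \<Gamma> ((f(Suc n := D)) i) ((f(Suc n := D)) (Suc i))"
      by cases (use assms in \<open>auto simp: partial_play_def\<close>)
  next
    fix i assume "enat i < enat (Suc n)"
    then consider "i < n" | "i = n" by fastforce
    then show "(turn ((f(Suc n := D)) (Suc i)) = turn ((f(Suc n := D)) i)) = (enat (Suc i) = enat (Suc n))"
      by cases (use assms in \<open>auto simp: partial_play_def\<close>)
  qed
  show "follows \<sigma> (f(Suc n := D)) (enat (Suc n))"
    unfolding follows_def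
  proof (intro allI impI)
    fix i assume i: "enat i < enat (Suc n)" and t: "turn ((f(Suc n := D)) i) = Proponent"
    have m: "map (f(Suc n := D)) [0..<Suc i] = map f [0..<Suc i]"
      using i by (intro map_upd_Suc) simp
    consider "i < n" | "i = n" using i by fastforce
    then show "(f(Suc n := D)) (Suc i) = \<sigma> (map (f(Suc n := D)) [0..<Suc i])"
      unfolding m by cases (use assms t in \<open>auto simp: partial_play_def\<close>)
  qed
qed

section \<open>Opponent's play along a countermodel\<close>

lemma frames_N_wf:
  assumes "F \<in> frames_N"
  shows "wf {(v, w). (w, v) \<in> acc F \<and> w \<noteq> v}"
  using assms unfolding wf_iff_no_infinite_down_chain frames_N_def by auto

lemma winning_strategy_sound:
  fixes F :: "('w, 'i) kframe" and \<Gamma> :: "('p, 'o) fm set"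
  assumes inf: "infinite (UNIV :: 'o set)"
    and F: "F \<in> frames_finN"
    and R: "\<forall>u v p. (u, v) \<in> acc F \<longrightarrow> R u p \<subseteq> R v p"
    and strat: "prop_strategy \<Gamma> \<sigma>"
    and wins: "\<forall>f N. play \<Gamma> C\<^sub>0 f N \<longrightarrow> follows \<sigma> f N \<longrightarrow> winner f N = Proponent"
    and "w \<in> worlds F" "partial_play \<Gamma> \<sigma> C\<^sub>0 f n" "turn (f n) = Opponent" "legal \<Gamma> (f n)"
    and "g ` objs (f n) \<subseteq> indiv F w"
    and "\<And>A. A \<in> opp_fms (f n) \<Longrightarrow> forces F g R w e A"
    and "A \<in> prop_fms (f n)" "\<not> forces F g R w e A"
  shows False
  using assms(6-)
proof (induction w arbitrary: f n g A rule: wf_induct_rule[OF frames_N_wf[of F]])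
  case 1
  then show ?case using F by (simp add: frames_finN_def)
next
  case (2 w)
  note prems = "2.prems"
  let ?O = "opp_fms (f n)" and ?P = "prop_fms (f n)" and ?\<Delta> = "objs (f n)"
  have kF: "is_kframe F" and FN: "F \<in> frames_N" and findom: "\<And>w. w \<in> worlds F \<Longrightarrow> finite (indiv F w)"
    using F by (auto simp: frames_finN_def frames_N_def)
  note persist = forces_persistent[where F = F and R = R, OF kF R]
  \<comment> \<open>At a maximal element \<open>v\<close> of \<open>Q\<close>, every formula of
    \<open>?P\<close> is forced strictly above \<open>v\<close>, as hypothesis \<open>above\<close>
    of the truth lemma demands.\<close>
  define Q where "Q = {v. (w, v) \<in> acc F \<and> (\<exists>A\<in>?P. \<not> forces F g R v e A)}"
  have "w \<in> Q"
    using prems is_kframe_refl[OF kF] by (auto simp: Q_def)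
  from wfE_min[OF frames_N_wf[OF FN] this] obtain v where vQ: "v \<in> Q"
    and max: "\<And>u. (u, v) \<in> {(v, w). (w, v) \<in> acc F \<and> w \<noteq> v} \<Longrightarrow> u \<notin> Q"
    by blast
  have wv: "(w, v) \<in> acc F" using vQ by (simp add: Q_def)
  have v: "v \<in> worlds F" using is_kframe_worlds[OF kF wv] by simp
  have max: "forces F g R u e A" if "(v, u) \<in> acc F" "u \<noteq> v" "A \<in> ?P" for u A
    using max[of u] that is_kframe_trans[OF kF wv that(1)] by (auto simp: Q_def)
  have fin\<Delta>: "finite ?\<Delta>" using prems(4) by (simp add: legal_def)
  \<comment> \<open>Every individual at \<open>v\<close> gets a fresh name, even if it has one
    already; the domain is finite and the supply of objects infinite.\<close>
  obtain E where E: "finite E" "card E = card (indiv F v)" "E \<subseteq> - ?\<Delta>"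
    using infinite_arbitrarily_large[of "- ?\<Delta>" "card (indiv F v)"] inf fin\<Delta>
    by (metis Compl_eq_Diff_UNIV Diff_infinite_finite)
  obtain k where k: "bij_betw k E (indiv F v)"
    using finite_same_card_bij[OF E(1) findom[OF v] E(2)] by blast
  define g' where "g' = (\<lambda>a. if a \<in> E then k a else g a)"
  define \<Delta>' where "\<Delta>' = ?\<Delta> \<union> E"
  have g': "forces F g' R u e A = forces F g R u e A" if "A \<in> instances \<Gamma> ?\<Delta>" for u A
  proof (rule forces_cong)
    fix c assume "c \<in> fm_consts A"
    then have "c \<in> ?\<Delta>"
      using fm_consts_instances[OF that] prems(4) by (auto simp: legal_def)
    then show "g' c = g c" using E(3) by (auto simp: g'_def)
  qed simp
  have g'_img: "g' ` \<Delta>' = indiv F v"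
  proof -
    have "g' ` E = indiv F v"
      using k by (auto simp: g'_def bij_betw_def)
    moreover have "g' ` ?\<Delta> \<subseteq> indiv F v"
      using prems(5) is_kframe_indiv[OF kF wv] E(3) by (auto simp: g'_def)
    ultimately show ?thesis by (auto simp: \<Delta>'_def)
  qed
  define X where "X = {A \<in> instances \<Gamma> \<Delta>'. forces F g' R v e A}"
  define C where "C = Position (?O \<union> X) ?P \<Delta>'"
  have mv: "fin_opp_move \<Gamma> (f n) C"
    unfolding fin_opp_move_def
    by (rule exI[of _ E], rule conjI[OF E(1)], rule exI[of _ X]) (auto simp: C_def X_def \<Delta>'_def)
  have legC: "legal \<Gamma> C" using fin_opp_move_legal(1)[OF mv] prems(4) .
  have Of: "forces F g' R v e A" if "A \<in> ?O" for A
  proof -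
    have "A \<in> instances \<Gamma> ?\<Delta>" using that prems(4) by (auto simp: legal_def)
    then show ?thesis using g' persist[OF prems(6)[OF that] wv] by simp
  qed
  have Oin: "A \<in> instances \<Gamma> \<Delta>'" if "A \<in> ?O" for A
    using that legC by (auto simp: legal_def C_def)
  \<comment> \<open>Earlier assertions are forced at \<open>v\<close> by persistence, so Opponent's
    formulas are now exactly the instances forced there.\<close>
  have OC: "A \<in> opp_fms C \<longleftrightarrow> A \<in> instances \<Gamma> \<Delta>' \<and> forces F g' R v e A" for A
    using Of Oin by (auto simp: C_def X_def)
  \<comment> \<open>Stated for every \<open>D\<close> that differs from \<open>C\<close> only in
    Proponent's formulas, so that it also applies after Proponent's reply.\<close>
  have holdsD: "holds D A \<longleftrightarrow> forces F g' R v e A"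
    if "opp_fms D = opp_fms C" "objs D = \<Delta>'"
      and "\<And>A u. \<lbrakk>A \<in> prop_fms D; (v, u) \<in> acc F; u \<noteq> v\<rbrakk> \<Longrightarrow> forces F g' R u e A"
      and "A \<in> instances \<Gamma> \<Delta>'" for D A
  proof (rule holds_iff_forces[where \<Gamma> = \<Gamma>, OF kF v])
    show "g' ` objs D = indiv F v" using g'_img that by simp
    show "A \<in> opp_fms D \<union> prop_fms D" if "A \<in> instances \<Gamma> (objs D)" "forces F g' R v e A" for A
      using that \<open>opp_fms D = opp_fms C\<close> \<open>objs D = \<Delta>'\<close> OC by auto
    show "forces F g' R v e (Atom p ts) = (Atom p ts \<in> opp_fms D)"
      if "Atom p ts \<in> instances \<Gamma> (objs D)" for p ts
      using that \<open>opp_fms D = opp_fms C\<close> \<open>objs D = \<Delta>'\<close> OC by auto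
    show "forces F g' R u e A" if "A \<in> opp_fms D \<union> prop_fms D" "(v, u) \<in> acc F" "u \<noteq> v" for A u
      using that \<open>opp_fms D = opp_fms C\<close> OC persist
        \<open>\<And>A u. \<lbrakk>A \<in> prop_fms D; (v, u) \<in> acc F; u \<noteq> v\<rbrakk> \<Longrightarrow> forces F g' R u e A\<close> by blast
    show "A \<in> instances \<Gamma> (objs D)" using that by simp
  qed
  obtain B where B: "B \<in> ?P" "\<not> forces F g' R v e B"
    using vQ prems(4) g' by (auto simp: Q_def legal_def)
  have turnD: "turn D = Proponent"
    if "opp_fms D = opp_fms C" "objs D = \<Delta>'" "?P \<subseteq> prop_fms D"
      and "\<And>A u. \<lbrakk>A \<in> prop_fms D; (v, u) \<in> acc F; u \<noteq> v\<rbrakk> \<Longrightarrow> forces F g' R u e A" for D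
  proof -
    note h = holdsD[OF that(1,2,4)]
    have "\<not> opp_mistake D"
      using h OC that(1) by (auto simp: opp_mistake_def)
    moreover have "B \<in> instances \<Gamma> \<Delta>'"
      using B(1) legC by (auto simp: legal_def C_def)
    then have "prop_mistake D"
      using h B that(3) by (auto simp: prop_mistake_def)
    ultimately show ?thesis by (simp add: turn_Proponent)
  qed
  have turnC: "turn C = Proponent"
  proof (rule turnD)
    show "forces F g' R u e A" if "A \<in> prop_fms C" "(v, u) \<in> acc F" "u \<noteq> v" for A u
      using max[of u A] g'[of A u] that prems(4) by (auto simp: C_def legal_def)
  qed (auto simp: C_def)
  define f1 where "f1 = f(Suc n := C)"
  have f1: "partial_play \<Gamma> \<sigma> C\<^sub>0 f1 (Suc n)"
    unfolding f1_def using prems(2)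
    by (rule partial_play_extend) (use mv prems(3) turnC in \<open>auto simp: move_def\<close>)
  have f1n: "f1 (Suc n) = C" by (simp add: f1_def)
  define D where "D = \<sigma> (map f1 [0..<Suc (Suc n)])"
  have pmD: "prop_move \<Gamma> C D"
    using prop_strategy_move[OF strat, of f1 "Suc n"] turnC f1n by (simp only: D_def)
  have mD: "move \<Gamma> (f1 (Suc n)) D"
    using pmD turnC f1n by (simp add: move_def)
  have turnDO: "turn D = Opponent"
  proof (rule ccontr)
    assume "turn D \<noteq> Opponent"
    then have "turn D = turn (f1 (Suc n))"
      using turnC f1n by (cases "turn D") auto
    note l = partial_play_lose[OF f1 mD this D_def]
    show False using wins l turnC f1n by simp
  qed
  define f2 where "f2 = f1(Suc (Suc n) := D)"
  have f2: "partial_play \<Gamma> \<sigma> C\<^sub>0 f2 (Suc (Suc n))"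
    unfolding f2_def using f1 mD
    by (rule partial_play_extend) (use turnDO turnC f1n D_def in auto)
  have f2n: "f2 (Suc (Suc n)) = D" by (simp add: f2_def)
  have D: "opp_fms D = opp_fms C" "objs D = \<Delta>'" "?P \<subseteq> prop_fms D"
    using pmD by (auto simp: prop_move_def C_def)
  \<comment> \<open>The contrapositive of \<open>turnD\<close>: the turn has passed, so some formula
    of Proponent fails at a world strictly above \<open>v\<close>.\<close>
  obtain A' u where u: "A' \<in> prop_fms D" "(v, u) \<in> acc F" "u \<noteq> v" "\<not> forces F g' R u e A'"
    using turnD[OF D] turnDO by auto
  have wu: "(w, u) \<in> acc F" using is_kframe_trans[OF kF wv u(2)] .
  have "w \<noteq> u" using is_kframe_antisym[OF kF] wv u(2,3) by blast
  show False
  proof (rule "2.IH"[of u f2 "Suc (Suc n)" g' A'])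
    show "(u, w) \<in> {(v, w). (w, v) \<in> acc F \<and> w \<noteq> v}" using wu \<open>w \<noteq> u\<close> by simp
    show "u \<in> worlds F" using is_kframe_worlds[OF kF wu] by simp
    show "g' ` objs (f2 (Suc (Suc n))) \<subseteq> indiv F u"
      using g'_img D f2n is_kframe_indiv[OF kF u(2)] by auto
    show "forces F g' R u e A" if "A \<in> opp_fms (f2 (Suc (Suc n)))" for A
      using that D f2n OC persist u(2) by auto
  qed (use f2 f2n turnDO u prop_move_legal(1)[OF pmD legC] in auto)
qed

lemma proponent_wins_imp_entails:
  fixes O\<^sub>0 :: "('p, 'o) fm set" and \<phi> :: "('p, 'o) fm"
  assumes inf: "infinite (UNIV :: 'o set)"
    and legal: "legal \<Gamma> (Position O\<^sub>0 {\<phi>} \<Delta>\<^sub>0)"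
    and \<Delta>\<^sub>0: "\<Delta>\<^sub>0 = constants_of (insert \<phi> O\<^sub>0)"
    and wins: "proponent_wins \<Gamma> (Position O\<^sub>0 {\<phi>} \<Delta>\<^sub>0)"
  shows "entails (frames_finN :: ('w, 'i) kframe set) O\<^sub>0 \<phi>"
proof (rule ccontr)
  let ?C = "Position O\<^sub>0 {\<phi>} \<Delta>\<^sub>0"
  assume "\<not> ?thesis"
  then obtain F :: "('w, 'i) kframe" and I R w e
    where F: "F \<in> frames_finN" and km: "is_kmodel \<Delta>\<^sub>0 F I R"
      and T: "\<And>A. A \<in> O\<^sub>0 \<Longrightarrow> true_in F I R A" and w: "w \<in> worlds F" and \<phi>: "\<not> forces F I R w e \<phi>"
    unfolding entails_def true_in_def \<Delta>\<^sub>0 by blast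
  obtain \<sigma> where strat: "prop_strategy \<Gamma> \<sigma>"
    and win: "\<forall>f N. play \<Gamma> ?C f N \<longrightarrow> follows \<sigma> f N \<longrightarrow> winner f N = Proponent"
    using wins unfolding proponent_wins_def by blast
  have R: "\<forall>u v p. (u, v) \<in> acc F \<longrightarrow> R u p \<subseteq> R v p"
    and I: "I ` \<Delta>\<^sub>0 \<subseteq> indiv F w"
    using km w by (auto simp: is_kmodel_def)
  have O: "\<And>A. A \<in> O\<^sub>0 \<Longrightarrow> forces F I R w e A"
    using T w by (auto simp: true_in_def)
  note lose = winning_strategy_sound[where F = F and R = R and g = I and e = e and w = w
      and \<Gamma> = \<Gamma> and \<sigma> = \<sigma> and A = \<phi>, OF inf F R strat win w]
  \<comment> \<open>A partial play of length 0 reads only \<open>f 0\<close>; the other values are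
    padding.\<close>
  define f where "f = (\<lambda>n::nat. ?C)"
  have f: "partial_play \<Gamma> \<sigma> ?C f 0"
    by (simp add: partial_play_def f_def)
  show False
  proof (cases "turn ?C")
    case Opponent
    then show ?thesis
      using lose[OF f] legal I O \<phi> by (auto simp: f_def)
  next
    case Proponent
    \<comment> \<open>If Proponent starts, one move of \<open>\<sigma>\<close> brings Opponent to
      move while his formulas, the objects and the presence of \<open>\<phi>\<close> are
      unchanged.\<close>
    define D where "D = \<sigma> (map f [0..<Suc 0])"
    have pm: "prop_move \<Gamma> ?C D"
      using prop_strategy_move[OF strat, of f 0] Proponent by (simp only: D_def f_def)
    have mD: "move \<Gamma> (f 0) D"
      using pm Proponent by (simp add: move_def f_def)
    have DO: "turn D = Opponent"
    proof (rule ccontr)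
      assume "turn D \<noteq> Opponent"
      then have "turn D = turn (f 0)"
        using Proponent by (cases "turn D") (auto simp: f_def)
      note l = partial_play_lose[OF f mD this D_def]
      show False using win l Proponent by (simp add: f_def)
    qed
    have f1: "partial_play \<Gamma> \<sigma> ?C (f(Suc 0 := D)) (Suc 0)"
      using f mD by (rule partial_play_extend) (use DO Proponent D_def in \<open>auto simp: f_def\<close>)
    have "opp_fms D = O\<^sub>0" "objs D = \<Delta>\<^sub>0" "\<phi> \<in> prop_fms D"
      using pm by (auto simp: prop_move_def)
    then show ?thesis
      using lose[OF f1] prop_move_legal(1)[OF pm legal] DO I O \<phi> by auto
  qed
qed


section \<open>Determinacy\<close>

text \<open>A certificate, free of ordinals, that the points of a set enter the least fixed point in
  stages: each lies in \<open>\<Phi>\<close> of its predecessors.\<close>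

definition rank_witness :: "('a set \<Rightarrow> 'a set) \<Rightarrow> 'a set \<times> 'a rel \<Rightarrow> bool" where
  "rank_witness \<Phi> k \<longleftrightarrow> wf (snd k) \<and> (\<forall>x\<in>fst k. x \<in> \<Phi> {y \<in> fst k. (y, x) \<in> snd k})"

text \<open>A well-order of all pairs assigns to each point the least certificate \<open>i x\<close>
  containing it. Points are then compared lexicographically: first by certificate, then by the
  relation of the common certificate.\<close>

lemma rank_witness_Union:
  assumes "mono \<Phi>"
  shows "\<exists>r. rank_witness \<Phi> (\<Union>{D. \<exists>r. rank_witness \<Phi> (D, r)}, r)"
proof -
  define K where "K = {k. rank_witness \<Phi> k}"
  define S where "S = \<Union>(fst ` K)"
  obtain wo :: "('a set \<times> 'a rel) rel" where wo: "Well_order wo" "Field wo = UNIV"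
    using well_ordering by metis
  have total: "total_on UNIV wo"
    using wo by (simp add: well_order_on_def linear_order_on_def)
  have wfwo: "wf (wo - Id)"
    using wo by (simp add: well_order_on_def)
  have "\<exists>k\<in>K. x \<in> fst k \<and> (\<forall>k'. (k', k) \<in> wo - Id \<longrightarrow> \<not> (k' \<in> K \<and> x \<in> fst k'))" if x: "x \<in> S" for x
  proof -
    obtain k where "k \<in> {k \<in> K. x \<in> fst k}" using x unfolding S_def by blast
    from wfE_min[OF wfwo this] show ?thesis by (metis (no_types, lifting) mem_Collect_eq)
  qed
  then obtain i where i: "\<And>x. x \<in> S \<Longrightarrow> i x \<in> K \<and> x \<in> fst (i x) \<and>
      (\<forall>k'. (k', i x) \<in> wo - Id \<longrightarrow> \<not> (k' \<in> K \<and> x \<in> fst k'))"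
    by metis
  define r where "r = {(y, x). x \<in> S \<and> y \<in> S \<and>
      ((i y, i x) \<in> wo - Id \<or> i y = i x \<and> (y, x) \<in> snd (i x))}"
  have "wf r"
  proof (rule wfUNIVI)
    fix P x assume H: "\<forall>x. (\<forall>y. (y, x) \<in> r \<longrightarrow> P y) \<longrightarrow> P x"
    \<comment> \<open>Lexicographic induction: the outer one runs over certificates, the inner one
      over the points assigned to \<open>k\<close>.\<close>
    have "\<forall>x\<in>S. i x = k \<longrightarrow> P x" for k
    proof (induction k rule: wf_induct_rule[OF wfwo])
      case (1 k)
      show ?case
      proof (intro ballI impI)
        fix x assume x: "x \<in> S" "i x = k"
        have wk: "wf (snd k)"
          using i[OF x(1)] x(2) by (simp add: K_def rank_witness_def)
        show "P x" using x
        proof (induction x rule: wf_induct_rule[OF wk])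
          case (1 x)
          have "P y" if yx: "(y, x) \<in> r" for y
          proof -
            consider "(i y, k) \<in> wo - Id" | "i y = k" "(y, x) \<in> snd k"
              using yx 1(3) unfolding r_def by auto
            then show ?thesis
              using yx "1.IH" \<open>\<And>y. (y, k) \<in> wo - Id \<Longrightarrow> \<forall>x\<in>S. i x = y \<longrightarrow> P x\<close>
              by cases (auto simp: r_def)
          qed
          then show ?case using H by blast
        qed
      qed
    qed
    then show "P x"
      using H by (cases "x \<in> S") (auto simp: r_def)
  qed
  moreover have "x \<in> \<Phi> {y \<in> S. (y, x) \<in> r}" if x: "x \<in> S" for x
  proof -
    have ix: "rank_witness \<Phi> (i x)" "x \<in> fst (i x)"
      using i[OF x] by (auto simp: K_def)
    \<comment> \<open>A predecessor \<open>y\<close> inside \<open>i x\<close> lies in that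
      certificate, so its least certificate is \<open>i x\<close> or an earlier one; either way
      \<open>y\<close> precedes \<open>x\<close> in \<open>r\<close>.\<close>
    have "{y \<in> fst (i x). (y, x) \<in> snd (i x)} \<subseteq> {y \<in> S. (y, x) \<in> r}"
    proof
      fix y assume y: "y \<in> {y \<in> fst (i x). (y, x) \<in> snd (i x)}"
      have yS: "y \<in> S" using y i[OF x] by (auto simp: S_def)
      have "(i x, i y) \<notin> wo - Id" using i[OF yS] i[OF x] y by blast
      then have "i y = i x \<or> (i y, i x) \<in> wo - Id"
        using total[unfolded total_on_def, THEN bspec, THEN bspec, of "i x" "i y"] by auto
      then show "y \<in> {y \<in> S. (y, x) \<in> r}" using yS x y by (auto simp: r_def)
    qed
    from monoD[OF assms this] show ?thesis
      using ix by (auto simp: rank_witness_def)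
  qed
  ultimately have "rank_witness \<Phi> (S, r)" by (simp add: rank_witness_def)
  moreover have "S = \<Union>{D. \<exists>r. rank_witness \<Phi> (D, r)}"
    by (force simp: S_def K_def)
  ultimately show ?thesis by auto
qed

text \<open>The union of all certified sets is closed under \<open>\<Phi>\<close>, hence contains
  the least fixed point; induction along its relation gives the converse inclusion.\<close>

lemma lfp_rank:
  assumes "mono \<Phi>"
  shows "\<exists>r. wf r \<and> (\<forall>x\<in>lfp \<Phi>. x \<in> \<Phi> {y \<in> lfp \<Phi>. (y, x) \<in> r})"
proof -
  define S where "S = \<Union>{D. \<exists>r. rank_witness \<Phi> (D, r)}"
  obtain r where r: "rank_witness \<Phi> (S, r)"
    using rank_witness_Union[OF assms] unfolding S_def by blast
  then have wf: "wf r" and rS: "\<And>x. x \<in> S \<Longrightarrow> x \<in> \<Phi> {y \<in> S. (y, x) \<in> r}"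
    by (auto simp: rank_witness_def)
  have "x \<in> S" if "x \<in> \<Phi> S" for x
  proof (rule ccontr)
    assume x: "x \<notin> S"
    \<comment> \<open>The missing point is placed above all of \<open>S\<close>, which would certify
      it.\<close>
    define r' where "r' = {(y, z). y \<in> S \<and> z \<in> S \<and> (y, z) \<in> r} \<union> S \<times> {x}"
    have "wf r'"
      unfolding r'_def
    proof (rule wf_Un)
      show "wf {(y, z). y \<in> S \<and> z \<in> S \<and> (y, z) \<in> r}"
        by (rule wf_subset[OF wf]) auto
      show "wf (S \<times> {x})"
        by (rule wf_subset[OF wf_measure[of "\<lambda>y. if y = x then 1 else 0"]]) (use x in auto)
    qed (use x in auto)
    moreover have "z \<in> \<Phi> {y \<in> insert x S. (y, z) \<in> r'}" if "z \<in> insert x S" for z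
    proof (cases "z = x")
      case True
      have "S \<subseteq> {y \<in> insert x S. (y, z) \<in> r'}" using True by (auto simp: r'_def)
      from monoD[OF assms this] show ?thesis using True \<open>x \<in> \<Phi> S\<close> by blast
    next
      case False
      then have "z \<in> S" using that by simp
      then have "{y \<in> S. (y, z) \<in> r} \<subseteq> {y \<in> insert x S. (y, z) \<in> r'}" by (auto simp: r'_def)
      from monoD[OF assms this] show ?thesis using rS[OF \<open>z \<in> S\<close>] by blast
    qed
    ultimately have "rank_witness \<Phi> (insert x S, r')" by (simp add: rank_witness_def)
    then have "x \<in> S" unfolding S_def by blast
    then show False using x by simp
  qed
  then have le: "lfp \<Phi> \<subseteq> S" by (intro lfp_lowerbound) auto
  have "S \<subseteq> lfp \<Phi>"
  proof
    fix x assume "x \<in> S"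
    then show "x \<in> lfp \<Phi>"
    proof (induction x rule: wf_induct_rule[OF wf])
      case (1 x)
      then have "{y \<in> S. (y, x) \<in> r} \<subseteq> lfp \<Phi>" by blast
      from monoD[OF assms this] have "x \<in> \<Phi> (lfp \<Phi>)" using rS[OF 1(2)] by blast
      then show ?case using lfp_unfold[OF assms] by simp
    qed
  qed
  with le have "S = lfp \<Phi>" by simp
  with wf rS show ?thesis by blast
qed

text \<open>One step of the attractor of a reachability game. A mover who keeps the turn loses, so
  only moves that pass the turn count; the base consists of positions where Proponent has to move
  but cannot pass the turn.\<close>

definition opp_attract :: "('p, 'o) fm set \<Rightarrow> ('p, 'o) position set \<Rightarrow> ('p, 'o) position set" where
  "opp_attract \<Gamma> W = {C.
     (turn C = Opponent \<longrightarrow> (\<exists>C'\<in>W. fin_opp_move \<Gamma> C C' \<and> turn C' = Proponent)) \<and>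
     (turn C = Proponent \<longrightarrow> (\<forall>C'. prop_move \<Gamma> C C' \<longrightarrow> turn C' = Opponent \<longrightarrow> C' \<in> W))}"

lemma mono_opp_attract: "mono (opp_attract \<Gamma>)"
  unfolding opp_attract_def by (rule monoI) blast

text \<open>Provides a default move where the strategy below has nothing to choose.\<close>

lemma prop_move_refl: "prop_move \<Gamma> C C"
  unfolding prop_move_def by (rule exI[of _ "{}"]) simp

text \<open>Outside the fixed point Proponent can pass the turn and stay outside, and Opponent
  cannot pass it into the fixed point. So a finite play ends with a failure of Opponent. The
  strategy is positional.\<close>

lemma proponent_wins_outside_attractor:
  assumes "C\<^sub>0 \<notin> lfp (opp_attract \<Gamma>)"
  shows "proponent_wins \<Gamma> C\<^sub>0"
proof -
  define W where "W = lfp (opp_attract \<Gamma>)"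
  have W: "W = opp_attract \<Gamma> W"
    unfolding W_def by (rule lfp_unfold[OF mono_opp_attract])
  have PW: "\<exists>C'. prop_move \<Gamma> C C' \<and> turn C' = Opponent \<and> C' \<notin> W"
    if "C \<notin> W" "turn C = Proponent" for C
  proof -
    have "C \<notin> opp_attract \<Gamma> W" using that W by simp
    then show ?thesis using that(2) by (auto simp: opp_attract_def)
  qed
  have OW: "C' \<notin> W"
    if "C \<notin> W" "turn C = Opponent" "fin_opp_move \<Gamma> C C'" "turn C' = Proponent" for C C'
  proof -
    have "C \<notin> opp_attract \<Gamma> W" using that W by simp
    then show ?thesis using that by (auto simp: opp_attract_def)
  qed
  define next_pos where "next_pos C = (if C \<notin> W \<and> turn C = Proponent
     then (SOME C'. prop_move \<Gamma> C C' \<and> turn C' = Opponent \<and> C' \<notin> W) else C)" for C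
  have nxt: "prop_move \<Gamma> C (next_pos C) \<and> turn (next_pos C) = Opponent \<and> next_pos C \<notin> W"
    if "C \<notin> W" "turn C = Proponent" for C
    using someI_ex[OF PW[OF that]] that by (simp add: next_pos_def)
  have nxt': "prop_move \<Gamma> C (next_pos C)" for C
    using nxt[of C] by (cases "C \<notin> W \<and> turn C = Proponent") (auto simp: next_pos_def prop_move_refl)
  have "winner f N = Proponent"
    if p: "play \<Gamma> C\<^sub>0 f N" and fo: "follows (next_pos \<circ> last) f N" for f N
  proof -
    have step: "f (Suc i) = next_pos (f i)" if "enat i < N" "turn (f i) = Proponent" for i
      using fo that unfolding follows_def by auto
    \<comment> \<open>The claim stops short of the last position: nothing is known after a move that
      fails to pass the turn.\<close>
    have out: "enat i < N \<Longrightarrow> f i \<notin> W" for i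
    proof (induction i)
      case 0
      then show ?case using p assms by (simp add: play_def W_def)
    next
      case (Suc i)
      have lt: "enat i < N" using Suc.prems by (metis Suc_ile_eq order_less_imp_le)
      have IH: "f i \<notin> W" using Suc.IH lt .
      have mv: "move \<Gamma> (f i) (f (Suc i))" and tn: "turn (f (Suc i)) \<noteq> turn (f i)"
        using p lt Suc.prems by (auto simp: play_def)
      show ?case
      proof (cases "turn (f i)")
        case Proponent
        then show ?thesis using step[OF lt] nxt[OF IH] by simp
      next
        case Opponent
        then show ?thesis
          using OW[OF IH Opponent, of "f (Suc i)"] mv tn by (cases "turn (f (Suc i))") (auto simp: move_def)
      qed
    qed
    show ?thesis
    proof (cases N)
      case (enat n)
      obtain m where m: "n = Suc m"
        using p enat by (cases n) (auto simp: play_def zero_enat_def)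
      have lt: "enat m < N" using enat m by simp
      have "turn (f (Suc m)) = turn (f m)"
        using p lt enat m by (auto simp: play_def)
      moreover have "turn (f m) = Opponent"
      proof (rule ccontr)
        assume "turn (f m) \<noteq> Opponent"
        then have P: "turn (f m) = Proponent" by (cases "turn (f m)") auto
        then have "turn (f (Suc m)) = Opponent"
          using step[OF lt P] nxt[OF out[OF lt] P] by simp
        then show False using \<open>turn (f (Suc m)) = turn (f m)\<close> P by simp
      qed
      ultimately show ?thesis using enat m by (simp add: winner_def)
    qed (simp add: winner_def)
  qed
  moreover have "prop_strategy \<Gamma> (next_pos \<circ> last)"
    using nxt' by (auto simp: prop_strategy_def)
  ultimately show ?thesis unfolding proponent_wins_def by blast
qed


section \<open>The countermodel of a winning strategy of Opponent\<close>

text \<open>Abstracts a region won by Opponent: \<open>N\<close> will hold won positions with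
  Proponent to move, \<open>lt\<close> orders positions by growth and falling rank, and
  \<open>reply\<close> joins a Proponent move that passes the turn with Opponent's answer.\<close>

locale opponent_strategy =
  fixes \<Gamma> :: "('p, 'o) fm set" and N :: "('p, 'o) position set" and lt :: "('p, 'o) position rel"
  assumes legal: "C \<in> N \<Longrightarrow> legal \<Gamma> C"
    and wf: "wf (lt\<inverse>)"
    and trans: "trans lt"
    and lt_le: "(C, D) \<in> lt \<Longrightarrow> position_le C D"
    and reply: "\<lbrakk>C \<in> N; prop_move \<Gamma> C C'; turn C' = Opponent\<rbrakk> \<Longrightarrow>
      \<exists>D\<in>N. (C, D) \<in> lt \<and> prop_fms D = prop_fms C'"
begin

text \<open>Positions appear as one-element lists to fit the type of worlds in the theorem. The set
  \<open>U\<close> is a parameter because the final set of worlds is found by recursion.\<close>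

definition frame :: "('p, 'o) position set \<Rightarrow> (('p, 'o) position list, 'o) kframe" where
  "frame U = \<lparr>worlds = (\<lambda>C. [C]) ` U,
     acc = {([C], [D]) | C D. C \<in> U \<and> D \<in> U \<and> (C = D \<or> (C, D) \<in> lt)},
     indiv = \<lambda>w. objs (hd w)\<rparr>"

definition val :: "('p, 'o) position list \<Rightarrow> 'p \<Rightarrow> 'o list set" where
  "val w p = {cs \<in> lists (objs (hd w)). Atom p (map Obj cs) \<in> opp_fms (hd w)}"

text \<open>Objects denote themselves, and the environment is arbitrary since instances are
  closed.\<close>

definition forced :: "('p, 'o) position set \<Rightarrow> ('p, 'o) position \<Rightarrow> ('p, 'o) fm \<Rightarrow> bool" where
  "forced U C A \<longleftrightarrow> forces (frame U) (\<lambda>c. c) val [C] undefined A"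

section \<open>The Kripke frame of positions\<close>

lemma lt_irrefl: "(C, C) \<notin> lt"
  using wf by (auto dest: wf_not_refl)

lemma lt_trans: "(C, D) \<in> lt \<Longrightarrow> (D, E) \<in> lt \<Longrightarrow> (C, E) \<in> lt"
  using trans by (rule transD)

lemma frame_acc: "([C], w) \<in> acc (frame U) \<longleftrightarrow> (\<exists>D. w = [D] \<and> C \<in> U \<and> D \<in> U \<and> (C = D \<or> (C, D) \<in> lt))"
  by (auto simp: frame_def)

lemma frame_accE:
  assumes "(v, w) \<in> acc (frame U)"
  obtains C D where "v = [C]" "w = [D]" "C \<in> U" "D \<in> U" "C = D \<or> (C, D) \<in> lt"
  using assms by (auto simp: frame_def)

lemma all_frame_acc:
  "(\<forall>v. ([C], v) \<in> acc (frame U) \<longrightarrow> Q v) \<longleftrightarrow>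
     (\<forall>D. C \<in> U \<and> D \<in> U \<and> (C = D \<or> (C, D) \<in> lt) \<longrightarrow> Q [D])"
  by (auto simp: frame_acc)

lemma frame_worlds: "worlds (frame U) = (\<lambda>C. [C]) ` U"
  by (simp add: frame_def)

lemma frame_indiv: "indiv (frame U) w = objs (hd w)"
  by (simp add: frame_def)

lemma is_kframe_frame: "is_kframe (frame U)"
proof -
  have "partial_order_on (worlds (frame U)) (acc (frame U))"
    unfolding partial_order_on_def preorder_on_def
  proof (intro conjI)
    show "acc (frame U) \<subseteq> worlds (frame U) \<times> worlds (frame U)"
      by (auto simp: frame_def)
    show "refl_on (worlds (frame U)) (acc (frame U))"
      by (auto simp: frame_def refl_on_def)
    show "Relation.trans (acc (frame U))"
      by (rule transI) (auto simp: frame_def intro: lt_trans)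
    show "antisym (acc (frame U))"
      by (rule antisymI) (auto simp: frame_def dest: lt_trans simp: lt_irrefl)
  qed
  moreover have "indiv (frame U) w \<subseteq> indiv (frame U) v" if "(w, v) \<in> acc (frame U)" for w v
    using that by (rule frame_accE) (use lt_le in \<open>auto simp: frame_indiv position_le_def\<close>)
  ultimately show ?thesis by (simp add: is_kframe_def)
qed

lemma val_mono: "\<forall>w v p. (w, v) \<in> acc (frame U) \<longrightarrow> val w p \<subseteq> val v p"
proof (intro allI impI)
  fix w v p assume "(w, v) \<in> acc (frame U)"
  then show "val w p \<subseteq> val v p"
    by (rule frame_accE) (auto simp: val_def position_le_def subset_iff dest!: lt_le)
qed

lemma frame_frames_N: "frame U \<in> frames_N"
proof -
  have False if f: "\<forall>n::nat. (f n, f (Suc n)) \<in> acc (frame U) \<and> f n \<noteq> f (Suc n)" for f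
  proof -
    have "(hd (f n), hd (f (Suc n))) \<in> lt" for n
    proof -
      have "(f n, f (Suc n)) \<in> acc (frame U)" "f n \<noteq> f (Suc n)" using f by auto
      then show ?thesis by (auto elim: frame_accE)
    qed
    then have "\<exists>h. \<forall>n. (h (Suc n), h n) \<in> lt\<inverse>"
      by (intro exI[of _ "\<lambda>n. hd (f n)"]) simp
    then show False using wf unfolding wf_iff_no_infinite_down_chain by simp
  qed
  then show ?thesis using is_kframe_frame by (auto simp: frames_N_def)
qed

lemma forced_persistent:
  assumes "forced U C A" "C \<in> U" "D \<in> U" "(C, D) \<in> lt"
  shows "forced U D A"
  using forces_persistent[OF is_kframe_frame val_mono assms(1)[unfolded forced_def], of "[D]"] assms(2-)
  by (simp add: forced_def frame_acc)

text \<open>Forcing only looks upwards, so worlds outside the cone of \<open>C\<close> may be added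
  or removed; transitivity of \<open>lt\<close> passes the agreement on to later worlds.\<close>

lemma forces_frame_cong:
  assumes "\<And>D. D = C \<or> (C, D) \<in> lt \<Longrightarrow> D \<in> U \<longleftrightarrow> D \<in> U'"
  shows "forces (frame U) (\<lambda>c. c) val [C] e A = forces (frame U') (\<lambda>c. c) val [C] e A"
  using assms
proof (induction A arbitrary: C e)
  case (Imp A B)
  have IH: "forces (frame U) (\<lambda>c. c) val [D] e A = forces (frame U') (\<lambda>c. c) val [D] e A"
    "forces (frame U) (\<lambda>c. c) val [D] e B = forces (frame U') (\<lambda>c. c) val [D] e B"
    if "D = C \<or> (C, D) \<in> lt" for D
    by (rule Imp.IH; use that Imp.prems lt_trans in blast)+
  show ?case
    unfolding forces.simps all_frame_acc
    by (intro all_cong1 imp_cong) (use IH Imp.prems in blast)+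
next
  case (Con A B)
  have "forces (frame U) (\<lambda>c. c) val [C] e A = forces (frame U') (\<lambda>c. c) val [C] e A"
    "forces (frame U) (\<lambda>c. c) val [C] e B = forces (frame U') (\<lambda>c. c) val [C] e B"
    by (rule Con.IH; use Con.prems in blast)+
  then show ?case by simp
next
  case (Dis A B)
  have "forces (frame U) (\<lambda>c. c) val [C] e A = forces (frame U') (\<lambda>c. c) val [C] e A"
    "forces (frame U) (\<lambda>c. c) val [C] e B = forces (frame U') (\<lambda>c. c) val [C] e B"
    by (rule Dis.IH; use Dis.prems in blast)+
  then show ?case by simp
next
  case (All x A)
  have IH: "forces (frame U) (\<lambda>c. c) val [D] e' A = forces (frame U') (\<lambda>c. c) val [D] e' A"
    if "D = C \<or> (C, D) \<in> lt" for D e'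
    by (rule All.IH; use that All.prems lt_trans in blast)
  show ?case
    unfolding forces.simps all_frame_acc frame_indiv
    by (intro all_cong1 imp_cong ball_cong refl) (use IH All.prems in blast)+
next
  case (Exi x A)
  have "forces (frame U) (\<lambda>c. c) val [C] e' A = forces (frame U') (\<lambda>c. c) val [C] e' A" for e'
    by (rule Exi.IH; use Exi.prems in blast)
  then show ?case by (simp add: frame_indiv)
qed simp_all

lemma forced_cong:
  "(\<And>D. D = C \<or> (C, D) \<in> lt \<Longrightarrow> D \<in> U \<longleftrightarrow> D \<in> U') \<Longrightarrow> forced U C A = forced U' C A"
  unfolding forced_def by (rule forces_frame_cong)

text \<open>The most that Proponent can truthfully assert over the worlds \<open>U\<close>; it
  supplies hypothesis \<open>forced\<close> of the truth lemma.\<close>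

definition saturate :: "('p, 'o) position set \<Rightarrow> ('p, 'o) position \<Rightarrow> ('p, 'o) position" where
  "saturate U C = Position (opp_fms C)
     (prop_fms C \<union> {A \<in> instances \<Gamma> (objs C). forced U C A}) (objs C)"

text \<open>Not every position can serve as a world: truth in a position only matches forcing once
  Proponent has asserted everything that is forced there.  A position is kept as a world if its
  assertions by Proponent are forced at all later worlds and if Proponent, on asserting everything
  that would be forced at it, still has to move.  If he does not, Opponent's reply
  leads to a later world that refutes an assertion made before.\<close>

definition good_step :: "('p, 'o) position \<Rightarrow> ('p, 'o) position set \<Rightarrow> bool" where
  "good_step C V \<longleftrightarrow> (\<forall>A\<in>prop_fms C. \<forall>D\<in>V. forced (insert C V) D A) \<and>
     turn (saturate (insert C V) C) = Proponent"

text \<open>Whether \<open>C\<close> becomes a world depends on which later positions are worlds,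
  hence the recursion along the converse of \<open>lt\<close>.\<close>

definition good :: "('p, 'o) position \<Rightarrow> bool" where
  "good = wfrec (lt\<inverse>) (\<lambda>g C. good_step C {D \<in> N. (C, D) \<in> lt \<and> g D})"

definition G :: "('p, 'o) position set" where
  "G = {C \<in> N. good C}"

lemma good_iff: "good C \<longleftrightarrow> good_step C {D \<in> N. (C, D) \<in> lt \<and> good D}"
proof -
  have "good C \<longleftrightarrow> good_step C {D \<in> N. (C, D) \<in> lt \<and> cut good (lt\<inverse>) C D}"
    using def_wfrec[OF good_def[THEN eq_reflection] wf, of C] .
  moreover have "{D \<in> N. (C, D) \<in> lt \<and> cut good (lt\<inverse>) C D} = {D \<in> N. (C, D) \<in> lt \<and> good D}"
    by (auto simp: cut_def)
  ultimately show ?thesis by simp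
qed

text \<open>Goodness is tested in the cone of \<open>C\<close> only; by \<open>forced_cong\<close>
  the whole frame \<open>G\<close> gives the same answers. Inserting \<open>C\<close> lets forcing
  at \<open>C\<close> be evaluated before it is known to be a world.\<close>

lemma G_iff:
  assumes "C \<in> N"
  shows "C \<in> G \<longleftrightarrow> (\<forall>A\<in>prop_fms C. \<forall>D\<in>G. (C, D) \<in> lt \<longrightarrow> forced G D A) \<and>
     turn (saturate (insert C G) C) = Proponent"
proof -
  define V where "V = {D \<in> N. (C, D) \<in> lt \<and> good D}"
  have V: "D \<in> V \<longleftrightarrow> D \<in> G \<and> (C, D) \<in> lt" for D
    by (auto simp: V_def G_def)
  have "forced (insert C V) D A = forced G D A" if "D \<in> V" for D A
    by (rule forced_cong) (use that V lt_trans lt_irrefl in blast)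
  moreover have "forced (insert C V) C A = forced (insert C G) C A" for A
    by (rule forced_cong) (use V in blast)
  then have "saturate (insert C V) C = saturate (insert C G) C"
    by (simp add: saturate_def)
  moreover have "C \<in> G \<longleftrightarrow> good_step C V"
    using assms good_iff[of C] by (simp add: G_def V_def)
  ultimately show ?thesis by (auto simp: good_step_def V)
qed

section \<open>Truth and forcing at the worlds of \<open>G\<close>\<close>

lemma G_N: "C \<in> G \<Longrightarrow> C \<in> N"
  by (simp add: G_def)

text \<open>Hypothesis \<open>above\<close> of the truth lemma has three sources: Opponent's
  formulas persist in later positions and fall under \<open>IH\<close>, Proponent's old ones are
  covered by goodness, and the added ones by persistence.\<close>

lemma holds_saturate:
  assumes C: "C \<in> G" and IH: "\<And>D A. \<lbrakk>D \<in> G; (C, D) \<in> lt; A \<in> opp_fms D\<rbrakk> \<Longrightarrow> forced G D A"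
    and A: "A \<in> instances \<Gamma> (objs C)"
  shows "holds (saturate G C) A \<longleftrightarrow> forced G C A"
  unfolding forced_def
proof (rule holds_iff_forces[where \<Gamma> = \<Gamma>])
  show "is_kframe (frame G)" by (rule is_kframe_frame)
  show "[C] \<in> worlds (frame G)" using C by (simp add: frame_worlds)
  show "(\<lambda>c. c) ` objs (saturate G C) = indiv (frame G) [C]"
    by (simp add: saturate_def frame_indiv)
  show "A \<in> instances \<Gamma> (objs (saturate G C))" using A by (simp add: saturate_def)
  show "A \<in> opp_fms (saturate G C) \<union> prop_fms (saturate G C)"
    if "A \<in> instances \<Gamma> (objs (saturate G C))" "forces (frame G) (\<lambda>c. c) val [C] undefined A" for A
    using that by (simp add: saturate_def forced_def)
  show "forces (frame G) (\<lambda>c. c) val [C] undefined (Atom p ts) = (Atom p ts \<in> opp_fms (saturate G C))"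
    if at: "Atom p ts \<in> instances \<Gamma> (objs (saturate G C))" for p ts
  proof -
    have "constants_of \<Gamma> \<subseteq> objs (saturate G C)"
      using legal[OF G_N[OF C]] by (simp add: legal_def saturate_def)
    with at obtain cs where "ts = map Obj cs" "set cs \<subseteq> objs (saturate G C)"
      by (rule instances_Atom)
    then show ?thesis by (auto simp: val_def saturate_def comp_def)
  qed
  show "forces (frame G) (\<lambda>c. c) val v undefined A"
    if A: "A \<in> opp_fms (saturate G C) \<union> prop_fms (saturate G C)"
      and v: "([C], v) \<in> acc (frame G)" "v \<noteq> [C]" for A v
  proof -
    obtain D where D: "v = [D]" "D \<in> G" "(C, D) \<in> lt"
      using v by (auto simp: frame_acc)
    consider "A \<in> opp_fms C" | "A \<in> prop_fms C" | "forced G C A"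
      using A by (auto simp: saturate_def)
    then have "forced G D A"
    proof cases
      case 1
      then have "A \<in> opp_fms D" using lt_le[OF D(3)] by (auto simp: position_le_def)
      then show ?thesis using IH D by blast
    next
      case 2
      then show ?thesis using C D G_iff[OF G_N[OF C]] by blast
    next
      case 3
      then show ?thesis using forced_persistent C D by blast
    qed
    then show ?thesis using D(1) by (simp add: forced_def)
  qed
qed

lemma turn_saturate: "C \<in> G \<Longrightarrow> turn (saturate G C) = Proponent"
  using G_iff[OF G_N] by (metis insert_absorb)

text \<open>Proponent has to move after saturation, so Opponent has no mistake there: his formulas
  are true, hence forced by the truth lemma. The induction provides \<open>IH\<close> for later
  worlds.\<close>

lemma opp_fms_forced: "C \<in> G \<Longrightarrow> A \<in> opp_fms C \<Longrightarrow> forced G C A"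
proof (induction C arbitrary: A rule: wf_induct_rule[OF wf])
  case (1 C)
  have "A \<in> instances \<Gamma> (objs C)"
    using legal[OF G_N[OF 1(2)]] 1(3) by (auto simp: legal_def)
  then have "holds (saturate G C) A \<longleftrightarrow> forced G C A"
    by (intro holds_saturate) (use 1 in auto)
  moreover have "holds (saturate G C) A"
    using turn_saturate[OF 1(2)] 1(3) by (auto simp: turn_Proponent opp_mistake_def saturate_def)
  ultimately show ?case by simp
qed

text \<open>At a world, Proponent's mistake after saturation is an old formula, since the added ones
  are forced. Otherwise an old formula already fails at a later world, or saturation passes the turn
  and Opponent's reply is a later position to which the induction applies.\<close>

lemma prop_fms_not_forced:
  "C \<in> N \<Longrightarrow> \<exists>D\<in>G. \<exists>A\<in>prop_fms C. (C = D \<or> (C, D) \<in> lt) \<and> \<not> forced G D A"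
proof (induction C rule: wf_induct_rule[OF wf])
  case (1 C)
  show ?case
  proof (cases "C \<in> G")
    case True
    obtain A where A: "A \<in> prop_fms (saturate G C)" "\<not> holds (saturate G C) A"
      using turn_saturate[OF True] by (auto simp: turn_Proponent prop_mistake_def)
    have "A \<in> instances \<Gamma> (objs C)"
      using A(1) legal[OF 1(2)] by (auto simp: legal_def saturate_def)
    then have "\<not> forced G C A"
      using holds_saturate[OF True] opp_fms_forced A(2) by blast
    then show ?thesis using True A(1) by (auto simp: saturate_def)
  next
    case False
    show ?thesis
    proof (cases "\<forall>A\<in>prop_fms C. \<forall>D\<in>G. (C, D) \<in> lt \<longrightarrow> forced G D A")
      case True
      define C' where "C' = saturate (insert C G) C"
      have "turn C' = Opponent"
        using G_iff[OF 1(2)] False True by (simp add: C'_def not_Proponent)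
      moreover have "prop_move \<Gamma> C C'"
        unfolding prop_move_def C'_def saturate_def
        by (rule exI[of _ "{A \<in> instances \<Gamma> (objs C). forced (insert C G) C A}"]) auto
      ultimately obtain D where D: "D \<in> N" "(C, D) \<in> lt" "prop_fms D = prop_fms C'"
        using reply[OF 1(2)] by blast
      then obtain E A where E: "E \<in> G" "A \<in> prop_fms D" "D = E \<or> (D, E) \<in> lt" "\<not> forced G E A"
        using "1.IH"[of D] by auto
      have CE: "(C, E) \<in> lt" using E(3) D(2) lt_trans by blast
      \<comment> \<open>A formula added by saturation is forced at \<open>C\<close> and so at
        \<open>E\<close>; inserting \<open>C\<close>, which lies below \<open>E\<close>, does not
        change forcing at \<open>E\<close>.\<close>
      have "A \<in> prop_fms C"
      proof (rule ccontr)
        assume "A \<notin> prop_fms C"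
        then have "forced (insert C G) C A"
          using E(2) D(3) by (simp add: C'_def saturate_def)
        then have "forced (insert C G) E A"
          using forced_persistent E(1) CE by blast
        moreover have "forced (insert C G) E A = forced G E A"
          by (rule forced_cong) (use E(1) CE lt_trans lt_irrefl in blast)
        ultimately show False using E(4) by simp
      qed
      then show ?thesis using E CE by blast
    qed blast
  qed
qed

end

text \<open>Were the initial position in the attractor, the rank would give an instance of the
  locale whose frame \<open>G\<close> is a countermodel.\<close>

lemma entails_imp_not_attractor:
  fixes O\<^sub>0 :: "('p, 'o) fm set" and \<phi> :: "('p, 'o) fm"
  assumes closed: "\<forall>A \<in> O\<^sub>0. closed_fm A" "closed_fm \<phi>"
    and legal0: "legal \<Gamma> (Position O\<^sub>0 {\<phi>} \<Delta>\<^sub>0)"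
    and \<Delta>\<^sub>0: "\<Delta>\<^sub>0 = constants_of (insert \<phi> O\<^sub>0)"
    and ent: "entails (frames_finN :: (('p, 'o) position list, 'o) kframe set) O\<^sub>0 \<phi>"
  shows "Position O\<^sub>0 {\<phi>} \<Delta>\<^sub>0 \<notin> lfp (opp_attract \<Gamma>)"
proof
  let ?C = "Position O\<^sub>0 {\<phi>} \<Delta>\<^sub>0"
  define W where "W = lfp (opp_attract \<Gamma>)"
  assume "?C \<in> lfp (opp_attract \<Gamma>)"
  then have CW: "?C \<in> W" by (simp add: W_def)
  obtain r where wfr: "wf r" and rW: "\<And>x. x \<in> W \<Longrightarrow> x \<in> opp_attract \<Gamma> {y \<in> W. (y, x) \<in> r}"
    using lfp_rank[OF mono_opp_attract[of \<Gamma>]] unfolding W_def by blast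
  have oppW: "\<exists>D\<in>W. (D, C) \<in> r \<and> fin_opp_move \<Gamma> C D \<and> turn D = Proponent"
    if "C \<in> W" "turn C = Opponent" for C
    using rW[OF that(1)] that(2) by (auto simp: opp_attract_def)
  have propW: "D \<in> W \<and> (D, C) \<in> r"
    if "C \<in> W" "turn C = Proponent" "prop_move \<Gamma> C D" "turn D = Opponent" for C D
    using rW[OF that(1)] that(2-) by (auto simp: opp_attract_def)
  \<comment> \<open>Staying above the initial position keeps all of \<open>O\<^sub>0\<close>
    asserted and lets every constant denote.\<close>
  define N where "N = {C \<in> W. turn C = Proponent \<and> legal \<Gamma> C \<and> position_le ?C C}"
  \<comment> \<open>Growth makes domains and valuation monotone; the falling rank makes the frame
    Noetherian.\<close>
  define lt where "lt = {(C, D). position_le C D \<and> (D, C) \<in> r\<^sup>+}"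
  interpret opponent_strategy \<Gamma> N lt
  proof
    show "legal \<Gamma> C" if "C \<in> N" for C using that by (simp add: N_def)
    show "wf (lt\<inverse>)"
      by (rule wf_subset[OF wf_trancl[OF wfr]]) (auto simp: lt_def)
    show "trans lt"
      by (rule transI) (auto simp: lt_def intro: position_le_trans trancl_trans)
    show "position_le C D" if "(C, D) \<in> lt" for C D
      using that by (simp add: lt_def)
    show "\<exists>D\<in>N. (C, D) \<in> lt \<and> prop_fms D = prop_fms C'"
      if C: "C \<in> N" and C': "prop_move \<Gamma> C C'" "turn C' = Opponent" for C C'
    proof -
      have C'W: "C' \<in> W" "(C', C) \<in> r"
        using propW[OF _ _ C'] C by (auto simp: N_def)
      obtain D where D: "D \<in> W" "(D, C') \<in> r" "fin_opp_move \<Gamma> C' D" "turn D = Proponent"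
        using oppW[OF C'W(1) C'(2)] by blast
      have le: "position_le C D"
        using prop_move_legal(2)[OF C'(1)] fin_opp_move_legal(2)[OF D(3)] by (rule position_le_trans)
      have "legal \<Gamma> D"
        using C by (auto simp: N_def intro: prop_move_legal(1)[OF C'(1)] fin_opp_move_legal(1)[OF D(3)])
      moreover have "position_le ?C D"
        using C le by (auto simp: N_def intro: position_le_trans)
      moreover have "prop_fms D = prop_fms C'"
        using D(3) by (auto simp: fin_opp_move_def)
      ultimately show ?thesis
        using D le C'W by (auto simp: N_def lt_def intro!: bexI[of _ D] intro: trancl_into_trancl)
    qed
  qed
  have le0: "position_le ?C ?C" by (simp add: position_le_def)
  \<comment> \<open>Opponent's first move, if he starts, leaves Proponent's formulas alone, so the
    formula refuted later is \<open>\<phi>\<close> itself.\<close>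
  have "\<exists>C\<in>N. prop_fms C = {\<phi>}"
  proof (cases "turn ?C")
    case Proponent
    then show ?thesis using CW legal0 le0 by (intro bexI[of _ ?C]) (auto simp: N_def)
  next
    case Opponent
    obtain D where D: "D \<in> W" "fin_opp_move \<Gamma> ?C D" "turn D = Proponent"
      using oppW[OF CW Opponent] by blast
    have "D \<in> N"
      using D legal0 fin_opp_move_legal[OF D(2)] by (auto simp: N_def)
    moreover have "prop_fms D = {\<phi>}" using D(2) by (auto simp: fin_opp_move_def)
    ultimately show ?thesis by blast
  qed
  then obtain E where E: "E \<in> G" "\<not> forced G E \<phi>"
    using prop_fms_not_forced by fastforce
  have inG: "O\<^sub>0 \<subseteq> opp_fms C" "\<Delta>\<^sub>0 \<subseteq> objs C" "finite (objs C)" if "C \<in> G" for C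
    using G_N[OF that] by (auto simp: N_def position_le_def legal_def)
  have "frame G \<in> frames_finN"
    using frame_frames_N inG(3) by (auto simp: frames_finN_def frame_worlds frame_indiv)
  moreover have "is_kmodel (constants_of (insert \<phi> O\<^sub>0)) (frame G) (\<lambda>c. c) val"
    using inG(2) val_mono[of G] unfolding is_kmodel_def \<Delta>\<^sub>0[symmetric]
    by (auto simp: frame_worlds frame_indiv val_def)
  moreover have "true_in (frame G) (\<lambda>c. c) val A" if "A \<in> O\<^sub>0" for A
  proof -
    have "forces (frame G) (\<lambda>c. c) val [C] e A" if "C \<in> G" for C e
    proof -
      have "forced G C A" using opp_fms_forced[OF that] inG(1)[OF that] \<open>A \<in> O\<^sub>0\<close> by blast
      moreover have "forces (frame G) (\<lambda>c. c) val [C] e A = forces (frame G) (\<lambda>c. c) val [C] undefined A"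
        by (rule forces_cong) (use closed \<open>A \<in> O\<^sub>0\<close> in \<open>auto simp: closed_fm_def\<close>)
      ultimately show ?thesis by (simp add: forced_def)
    qed
    then show ?thesis by (auto simp: true_in_def frame_worlds)
  qed
  ultimately have "true_in (frame G) (\<lambda>c. c) val \<phi>"
    using ent unfolding entails_def by blast
  then show False using E by (auto simp: true_in_def frame_worlds forced_def)
qed

text \<open>A formula cannot quantify over types. The equivalence therefore uses types large enough
  for the countermodel built from positions, and the second conjunct extends soundness to arbitrary
  types of worlds and individuals. The infinite universe of objects supplies fresh names.\<close>

theorem theorem3:
  fixes O\<^sub>0 :: "('p, 'o) fm set" and \<phi> :: "('p, 'o) fm"
    and \<Gamma> :: "('p, 'o) fm set" and \<Delta>\<^sub>0 :: "'o set"
  assumes "infinite (UNIV :: 'o set)"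
    and "\<forall>A \<in> O\<^sub>0. closed_fm A" and "closed_fm \<phi>"
    and "\<Gamma> = O\<^sub>0 \<union> {\<phi>}"
    and "\<Delta>\<^sub>0 = constants_of \<Gamma>" and "finite \<Delta>\<^sub>0"
  shows "(proponent_wins \<Gamma> (Position O\<^sub>0 {\<phi>} \<Delta>\<^sub>0) \<longleftrightarrow>
            entails (frames_finN :: (('p, 'o) position list, 'o) kframe set) O\<^sub>0 \<phi>)
       \<and> (proponent_wins \<Gamma> (Position O\<^sub>0 {\<phi>} \<Delta>\<^sub>0) \<longrightarrow>
            entails (frames_finN :: ('w, 'i) kframe set) O\<^sub>0 \<phi>)"
proof -
  have legal: "legal \<Gamma> (Position O\<^sub>0 {\<phi>} \<Delta>\<^sub>0)"
    using assms by (auto simp: legal_def intro: instances_closed)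
  have \<Delta>\<^sub>0: "\<Delta>\<^sub>0 = constants_of (insert \<phi> O\<^sub>0)"
    using assms(4,5) by simp
  note sound = proponent_wins_imp_entails[OF assms(1) legal \<Delta>\<^sub>0]
  note complete = proponent_wins_outside_attractor[OF
      entails_imp_not_attractor[OF assms(2,3) legal \<Delta>\<^sub>0]]
  show ?thesis
    by (rule conjI[OF iffI[OF sound complete] impI[OF sound]])
qed

end
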